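(* Let $n\ge 1$ and $m\ge 0$ be integers, let $g(x)=x(1+x)$, and let $$L_{n,m}=\frac{1}{n!}\,\mathrm{CT}_x\,\frac{\prod_{r=1}^n(1+x_r^{-1})^m\prod_{1\le i< j \le n}(x_i-x_j)\left(g(x_i^{-1})-g(x_j^{-1})\right)}{\prod_{i=1}^n (1-x_i)\prod_{1\le i<j\le n} (1-x_ix_j) }.$$ Set $z=x+2+x^{-1}=x^{-1}(1+x)^2$. If $n=2k$, then $$L_{n,m}=\frac{1}{2^k}\det\left(\mathrm{CT}_x\, z^{m+k+j-i}(z-1)^{3i-2}\right)_{1\le i,j\le k};$$ if $n=2k+1$, then $$L_{n,m}=\frac{2^m}{2^k}\det\left(\mathrm{CT}_x\, z^{m+k+j-i}(z-1)^{3i-2}(2z+1)(4-z)\right)_{1\le i,j\le k}.$$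
   Context: In the definition of $L_{n,m}$ the rational function is viewed in the ring $\mathbb{Q}((x_1,\dots,x_n))$ of formal Laurent series; that is, $\frac{1}{1-x_i}$ and $\frac{1}{1-x_ix_j}$ are expanded as power series in the $x$'s, and $\mathrm{CT}_x$ denotes the constant term in all variables $x_1,\dots,x_n$. In the determinants, $\mathrm{CT}_x$ is the coefficient of $x^0$ of a Laurent polynomial in the single variable $x$. An empty determinant equals $1$. *)

theory Defs
  imports
    "HOL-Library.Poly_Mapping"
    "HOL-Computational_Algebra.Formal_Laurent_Series"
    "Jordan_Normal_Form.Determinant"
begin

section \<open>Multivariate formal Laurent series\<close>

text \<open>
  An exponent vector is a finitely supported function from variable indices to integers.
  A formal Laurent series is a coefficient function that involves only finitely many
  variables and whose exponents are bounded below; it is thus an element of some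
  \<open>R((x\<^sub>1, \<dots>, x\<^sub>n))\<close>. Since the number of variables is a parameter that cannot be
  a type index, the type below is the union of these rings over all finite sets of variables.
\<close>

type_synonym expo = "nat \<Rightarrow>\<^sub>0 int"

definition laurent_bd :: "nat set \<Rightarrow> int \<Rightarrow> (expo \<Rightarrow> 'a::zero) \<Rightarrow> bool" where
  "laurent_bd V N f \<longleftrightarrow>
     (\<forall>e. f e \<noteq> 0 \<longrightarrow> Poly_Mapping.keys e \<subseteq> V \<and> (\<forall>i. - N \<le> Poly_Mapping.lookup e i))"

typedef (overloaded) 'a mls =
  "{f :: expo \<Rightarrow> 'a::zero. \<exists>V N. finite V \<and> laurent_bd V N f}"
  morphisms coeff_mls Abs_mls
  by (rule exI[of _ "\<lambda>_. 0"]) (auto simp: laurent_bd_def)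

setup_lifting type_definition_mls

lemma mls_eqI: "(\<And>e. coeff_mls f e = coeff_mls g e) \<Longrightarrow> f = g"
  by (metis coeff_mls_inject ext)

lemma laurent_bd_mono:
  "laurent_bd V N f \<Longrightarrow> V \<subseteq> V' \<Longrightarrow> N \<le> N' \<Longrightarrow> laurent_bd V' N' f"
  unfolding laurent_bd_def by (meson dual_order.trans neg_le_iff_le)

lemma laurent_bd_common:
  assumes "\<exists>V N. finite V \<and> laurent_bd V N f" "\<exists>V N. finite V \<and> laurent_bd V N g"
  obtains V N where "finite V" "0 \<le> N" "laurent_bd V N f" "laurent_bd V N g"
proof -
  from assms obtain V N W M where "finite V" "laurent_bd V N f" "finite W" "laurent_bd W M g"
    by blast
  then show thesis
    by (intro that[of "V \<union> W" "max 0 (max N M)"])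
       (auto intro: laurent_bd_mono[of V N] laurent_bd_mono[of W M])
qed

definition expo_box :: "nat set \<Rightarrow> int \<Rightarrow> expo set" where
  "expo_box V M = {e. Poly_Mapping.keys e \<subseteq> V \<and> (\<forall>i. \<bar>Poly_Mapping.lookup e i\<bar> \<le> M)}"

lemma finite_expo_box:
  assumes "finite V"
  shows "finite (expo_box V M)"
proof -
  have "Poly_Mapping.lookup ` expo_box V M
          \<subseteq> {f. \<forall>i. (i \<in> V \<longrightarrow> f i \<in> {-M..M}) \<and> (i \<notin> V \<longrightarrow> f i = 0)}"
    by (auto simp: expo_box_def abs_le_iff in_keys_iff minus_le_iff)
  moreover have "finite {f. \<forall>i. (i \<in> V \<longrightarrow> f i \<in> {-M..M}) \<and> (i \<notin> V \<longrightarrow> f i = (0::int))}"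
    by (rule finite_set_of_finite_funs) (use assms in auto)
  ultimately have "finite (Poly_Mapping.lookup ` expo_box V M)"
    using finite_subset by blast
  then show ?thesis
    by (rule finite_imageD) (auto intro!: inj_onI poly_mapping_eqI)
qed

lemma expo_bounded:
  fixes c :: expo
  obtains M where "0 \<le> M" "\<And>i. \<bar>Poly_Mapping.lookup c i\<bar> \<le> M"
proof
  let ?M = "\<Sum>i\<in>Poly_Mapping.keys c. \<bar>Poly_Mapping.lookup c i\<bar>"
  show "0 \<le> ?M" by (simp add: sum_nonneg)
  show "\<bar>Poly_Mapping.lookup c i\<bar> \<le> ?M" for i
  proof (cases "i \<in> Poly_Mapping.keys c")
    case True
    then show ?thesis by (intro member_le_sum) auto
  next
    case False
    then show ?thesis using \<open>0 \<le> ?M\<close> by (simp add: in_keys_iff)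
  qed
qed

definition conv :: "(expo \<Rightarrow> 'a::semiring_0) \<Rightarrow> (expo \<Rightarrow> 'a) \<Rightarrow> expo \<Rightarrow> 'a" where
  "conv f g c = (\<Sum>a | f a \<noteq> 0 \<and> g (c - a) \<noteq> 0. f a * g (c - a))"

lemma conv_supp_box:
  assumes "laurent_bd V N f" "laurent_bd V N g" "\<And>i. \<bar>Poly_Mapping.lookup c i\<bar> \<le> M" "0 \<le> N"
    and "f a \<noteq> 0" "g (c - a) \<noteq> 0"
  shows "a \<in> expo_box V (M + N)"
proof -
  have "Poly_Mapping.keys a \<subseteq> V" and 1: "\<And>i. - N \<le> Poly_Mapping.lookup a i"
    using assms(1,5) by (auto simp: laurent_bd_def)
  moreover have "\<And>i. - N \<le> Poly_Mapping.lookup c i - Poly_Mapping.lookup a i"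
    using assms(2,6) by (auto simp: laurent_bd_def lookup_minus)
  then have "\<bar>Poly_Mapping.lookup a i\<bar> \<le> M + N" for i
    using 1[of i] assms(3)[of i] by (smt (verit))
  ultimately show ?thesis by (auto simp: expo_box_def)
qed

lemma conv_finite_supp:
  assumes "\<exists>V N. finite V \<and> laurent_bd V N f" "\<exists>V N. finite V \<and> laurent_bd V N g"
  shows "finite {a. f a \<noteq> 0 \<and> g (c - a) \<noteq> 0}"
proof -
  obtain V N where *: "finite V" "0 \<le> N" "laurent_bd V N f" "laurent_bd V N g"
    using laurent_bd_common[OF assms] .
  obtain M where "\<And>i. \<bar>Poly_Mapping.lookup c i\<bar> \<le> M"
    using expo_bounded by blast
  then have "{a. f a \<noteq> 0 \<and> g (c - a) \<noteq> 0} \<subseteq> expo_box V (M + N)"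
    using conv_supp_box[OF *(3,4) _ *(2)] by blast
  then show ?thesis using finite_expo_box[OF *(1)] finite_subset by blast
qed

lemma conv_eq_sum:
  assumes "finite A" "\<And>a. f a \<noteq> 0 \<Longrightarrow> g (c - a) \<noteq> 0 \<Longrightarrow> a \<in> A"
  shows "conv f g c = (\<Sum>a\<in>A. f a * g (c - a))"
  unfolding conv_def by (rule sum.mono_neutral_left) (use assms in auto)

lemma conv_nonzeroD:
  assumes "conv f g c \<noteq> 0"
  obtains a where "f a \<noteq> 0" "g (c - a) \<noteq> 0"
proof (cases "{a. f a \<noteq> 0 \<and> g (c - a) \<noteq> 0} = {}")
  case True
  then have "conv f g c = 0" unfolding conv_def by (simp only: sum.empty)
  with assms show thesis by simp
qed (use that in blast)

lemma conv_bd: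
  assumes "laurent_bd V N f" "laurent_bd V N g"
  shows "laurent_bd V (2 * N) (conv f g)"
  unfolding laurent_bd_def
proof (intro allI impI)
  fix c assume "conv f g c \<noteq> 0"
  then obtain a where "f a \<noteq> 0" "g (c - a) \<noteq> 0" by (rule conv_nonzeroD)
  then have *: "Poly_Mapping.keys a \<subseteq> V" "Poly_Mapping.keys (c - a) \<subseteq> V"
      "\<And>i. - N \<le> Poly_Mapping.lookup a i" "\<And>i. - N \<le> Poly_Mapping.lookup (c - a) i"
    using assms unfolding laurent_bd_def by blast+
  have "Poly_Mapping.keys c \<subseteq> V"
    using keys_add[of a "c - a"] *(1,2) by auto
  moreover have "- (2 * N) \<le> Poly_Mapping.lookup c i" for i
    using *(3)[of i] *(4)[of i] by (simp add: lookup_minus)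
  ultimately show "Poly_Mapping.keys c \<subseteq> V \<and> (\<forall>i. - (2 * N) \<le> Poly_Mapping.lookup c i)"
    by blast
qed

lemma conv_commute:
  fixes f g :: "expo \<Rightarrow> 'a::comm_semiring_0"
  shows "conv f g c = conv g f c"
  unfolding conv_def
  by (rule sum.reindex_bij_witness[of _ "\<lambda>a. c - a" "\<lambda>a. c - a"]) (auto simp: mult.commute)

lemma conv_add:
  assumes "\<exists>V N. finite V \<and> laurent_bd V N f" "\<exists>V N. finite V \<and> laurent_bd V N g"
    "\<exists>V N. finite V \<and> laurent_bd V N h"
  shows "conv (\<lambda>e. f e + g e) h c = conv f h c + conv g h c"
proof -
  let ?A = "{a. f a \<noteq> 0 \<and> h (c - a) \<noteq> 0} \<union> {a. g a \<noteq> 0 \<and> h (c - a) \<noteq> 0}"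
  have fin: "finite ?A"
    using conv_finite_supp[OF assms(1,3), of c] conv_finite_supp[OF assms(2,3), of c] by simp
  have "conv (\<lambda>e. f e + g e) h c = (\<Sum>a\<in>?A. (f a + g a) * h (c - a))"
    by (rule conv_eq_sum[OF fin]) auto
  moreover have "conv f h c = (\<Sum>a\<in>?A. f a * h (c - a))"
    by (rule conv_eq_sum[OF fin]) auto
  moreover have "conv g h c = (\<Sum>a\<in>?A. g a * h (c - a))"
    by (rule conv_eq_sum[OF fin]) auto
  ultimately show ?thesis by (simp add: distrib_right sum.distrib)
qed

lemma conv_assoc:
  assumes "\<exists>V N. finite V \<and> laurent_bd V N f" "\<exists>V N. finite V \<and> laurent_bd V N g"
    "\<exists>V N. finite V \<and> laurent_bd V N h"
  shows "conv (conv f g) h c = conv f (conv g h) c"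
proof -
  obtain V N where fg: "finite V" "0 \<le> N" "laurent_bd V N f" "laurent_bd V N g"
    using laurent_bd_common[OF assms(1,2)] .
  obtain W L where h: "finite W" "laurent_bd W L h" using assms(3) by blast
  define U where "U = V \<union> W"
  define K where "K = max N L"
  have K: "0 \<le> K" and U: "finite U" using fg h by (auto simp: K_def U_def)
  have bd: "laurent_bd U K f" "laurent_bd U K g" "laurent_bd U K h"
    using fg h by (auto simp: K_def U_def intro: laurent_bd_mono)
  have bd2: "laurent_bd U (2 * K) f" "laurent_bd U (2 * K) g" "laurent_bd U (2 * K) h"
    using bd K by (auto intro: laurent_bd_mono[of U K])
  have bdc: "laurent_bd U (2 * K) (conv f g)" "laurent_bd U (2 * K) (conv g h)"
    using bd conv_bd by blast+
  obtain M where M: "\<And>i. \<bar>Poly_Mapping.lookup c i\<bar> \<le> M" using expo_bounded by blast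
  define A where "A = expo_box U (M + 2 * K)"
  have A: "finite A" unfolding A_def using finite_expo_box[OF U] .
  have inA: "a \<in> A" if "laurent_bd U (2*K) p" "laurent_bd U (2*K) q" "p a \<noteq> 0" "q (c - a) \<noteq> 0"
    for p q :: "expo \<Rightarrow> 'a" and a
    unfolding A_def using conv_supp_box[OF that(1,2) M _ that(3,4)] K by simp
  have conv_h: "conv f g b * h (c - b) = (\<Sum>a\<in>A. f a * (g (b - a) * h (c - b)))" for b
  proof (cases "h (c - b) = 0")
    case False
    have "conv f g b = (\<Sum>a\<in>A. f a * g (b - a))"
    proof (rule conv_eq_sum[OF A])
      fix a assume "f a \<noteq> 0" and g: "g (b - a) \<noteq> 0"
      have keys: "Poly_Mapping.keys (b - a) \<subseteq> U" "Poly_Mapping.keys (c - b) \<subseteq> U"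
        and low: "- K \<le> Poly_Mapping.lookup (b - a) i"
          "- K \<le> Poly_Mapping.lookup (c - b) i" for i
        using bd(2,3) g False unfolding laurent_bd_def by blast+
      have a: "Poly_Mapping.keys a \<subseteq> U" "- K \<le> Poly_Mapping.lookup a i" for i
        using bd(1) \<open>f a \<noteq> 0\<close> unfolding laurent_bd_def by blast+
      have "\<bar>Poly_Mapping.lookup a i\<bar> \<le> M + 2 * K" for i
        using low[of i] a(2)[of i] M[of i] K by (auto simp: lookup_minus)
      then show "a \<in> A" using a(1) by (auto simp: A_def expo_box_def)
    qed
    then show ?thesis by (simp add: sum_distrib_right mult.assoc)
  qed simp
  have conv_gh: "f a * conv g h (c - a) = (\<Sum>b\<in>A. f a * (g (b - a) * h (c - b)))" for a
  proof (cases "f a = 0")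
    case False
    have "conv g h (c - a) = (\<Sum>d\<in>(\<lambda>b. b - a) ` A. g d * h (c - a - d))"
    proof (rule conv_eq_sum)
      show "finite ((\<lambda>b. b - a) ` A)" using A by simp
      fix d assume "g d \<noteq> 0" and "h (c - a - d) \<noteq> 0"
      then have d: "Poly_Mapping.keys d \<subseteq> U" "- K \<le> Poly_Mapping.lookup d i"
        and e: "- K \<le> Poly_Mapping.lookup (c - a - d) i" for i
        using bd(2,3) unfolding laurent_bd_def by blast+
      have a: "Poly_Mapping.keys a \<subseteq> U" "- K \<le> Poly_Mapping.lookup a i" for i
        using bd(1) False unfolding laurent_bd_def by blast+
      have "\<bar>Poly_Mapping.lookup (d + a) i\<bar> \<le> M + 2 * K" for i
        using d(2)[of i] a(2)[of i] e[of i] M[of i] K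
        by (auto simp: lookup_minus lookup_add)
      moreover have "Poly_Mapping.keys (d + a) \<subseteq> U"
        using keys_add[of d a] a(1) d(1) by blast
      ultimately have "d + a \<in> A" by (auto simp: A_def expo_box_def)
      then show "d \<in> (\<lambda>b. b - a) ` A" by (metis add_diff_cancel_right' image_eqI)
    qed
    also have "\<dots> = (\<Sum>b\<in>A. g (b - a) * h (c - b))"
      by (subst sum.reindex) (auto simp: inj_on_def)
    finally show ?thesis by (simp add: sum_distrib_left)
  qed simp
  have "conv (conv f g) h c = (\<Sum>b\<in>A. conv f g b * h (c - b))"
    by (rule conv_eq_sum[OF A]) (rule inA[OF bdc(1) bd2(3)])
  also have "\<dots> = (\<Sum>a\<in>A. \<Sum>b\<in>A. f a * (g (b - a) * h (c - b)))"
    unfolding conv_h by (rule sum.swap)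
  also have "\<dots> = (\<Sum>a\<in>A. f a * conv g h (c - a))"
    unfolding conv_gh ..
  also have "\<dots> = conv f (conv g h) c"
    by (rule conv_eq_sum[OF A, symmetric]) (rule inA[OF bd2(1) bdc(2)])
  finally show ?thesis .
qed

definition monom_mls :: "expo \<Rightarrow> 'a::zero \<Rightarrow> 'a mls" where
  "monom_mls e c = Abs_mls (\<lambda>e'. if e' = e then c else 0)"

lemma coeff_monom_fun: "coeff_mls (monom_mls e c) = (\<lambda>e'. if e' = e then c else 0)"
  unfolding monom_mls_def
proof (rule Abs_mls_inverse)
  obtain M where "\<And>i. \<bar>Poly_Mapping.lookup e i\<bar> \<le> M" using expo_bounded by blast
  then have "laurent_bd (Poly_Mapping.keys e) M (\<lambda>e'. if e' = e then c else 0)"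
    by (auto simp: laurent_bd_def abs_le_iff minus_le_iff)
  then show "(\<lambda>e'. if e' = e then c else 0) \<in> {f. \<exists>V N. finite V \<and> laurent_bd V N f}"
    using finite_keys by blast
qed

lemma laurent_bd_add:
  fixes f g :: "expo \<Rightarrow> 'a::monoid_add"
  assumes "\<exists>V N. finite V \<and> laurent_bd V N f" "\<exists>V N. finite V \<and> laurent_bd V N g"
  shows "\<exists>V N. finite V \<and> laurent_bd V N (\<lambda>e. f e + g e)"
proof -
  obtain V N where "finite V" "laurent_bd V N f" "laurent_bd V N g"
    using laurent_bd_common[OF assms] .
  moreover from this have "laurent_bd V N (\<lambda>e. f e + g e)"
    unfolding laurent_bd_def by (metis add.right_neutral)
  ultimately show ?thesis by blast
qed

lemma laurent_bd_uminus:
  fixes f :: "expo \<Rightarrow> 'a::group_add"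
  shows "laurent_bd V N (\<lambda>e. - f e) = laurent_bd V N f"
  by (simp add: laurent_bd_def)

instantiation mls :: (comm_ring_1) comm_ring_1
begin

lift_definition zero_mls :: "'a mls" is "\<lambda>_. 0"
  by (auto simp: laurent_bd_def)

definition one_mls :: "'a mls" where "1 = monom_mls 0 1"

lift_definition plus_mls :: "'a mls \<Rightarrow> 'a mls \<Rightarrow> 'a mls" is "\<lambda>f g e. f e + g e"
  by (rule laurent_bd_add)

lift_definition uminus_mls :: "'a mls \<Rightarrow> 'a mls" is "\<lambda>f e. - f e"
  by (simp add: laurent_bd_uminus)

lift_definition minus_mls :: "'a mls \<Rightarrow> 'a mls \<Rightarrow> 'a mls" is "\<lambda>f g e. f e - g e"
  unfolding diff_conv_add_uminus by (rule laurent_bd_add) (simp_all add: laurent_bd_uminus)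

lift_definition times_mls :: "'a mls \<Rightarrow> 'a mls \<Rightarrow> 'a mls" is conv
  by (metis conv_bd laurent_bd_common)

lemma conv_unit: "conv (\<lambda>e'. if e' = e then 1 else 0) f c = f (c - e)"
  for f :: "expo \<Rightarrow> 'a"
  by (subst conv_eq_sum[where A = "{e}"]) (auto split: if_splits)

instance
proof
  fix a b c :: "'a mls"
  show "a * b * c = a * (b * c)"
    by transfer (rule ext, rule conv_assoc)
  show "a * b = b * a"
    by transfer (rule ext, rule conv_commute)
  show "1 * a = a"
    by (rule mls_eqI) (simp add: one_mls_def times_mls.rep_eq coeff_monom_fun conv_unit)
  show "(a + b) * c = a * c + b * c"
    by transfer (rule ext, rule conv_add)
  show "a + b + c = a + (b + c)" by transfer (simp add: add.assoc)
  show "a + b = b + a" by transfer (simp add: add.commute)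
  show "0 + a = a" by transfer simp
  show "- a + a = 0" by transfer simp
  show "a - b = a + - b" by transfer simp
  show "(0::'a mls) \<noteq> 1"
    unfolding one_mls_def by (metis coeff_monom_fun zero_mls.rep_eq zero_neq_one)
qed

end

lemma coeff_monom_times: "coeff_mls (monom_mls e 1 * f) c = coeff_mls f (c - e)"
  by (simp add: times_mls.rep_eq coeff_monom_fun conv_unit)

lemma coeff_mls_simps:
  "coeff_mls 0 e = 0"
  "coeff_mls (f + g) e = coeff_mls f e + coeff_mls g e"
  "coeff_mls (f - g) e = coeff_mls f e - coeff_mls g e"
  "coeff_mls (- f) e = - coeff_mls f e"
  by (simp_all add: zero_mls.rep_eq plus_mls.rep_eq minus_mls.rep_eq uminus_mls.rep_eq)

lemma coeff_monom: "coeff_mls (monom_mls e c) e' = (if e' = e then c else 0)"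
  by (simp add: coeff_monom_fun)

lemma monom_mult_monom: "monom_mls a 1 * monom_mls b 1 = (monom_mls (a + b) 1 :: 'a::comm_ring_1 mls)"
  by (rule mls_eqI) (auto simp: coeff_monom_times coeff_monom algebra_simps)


subsection \<open>Fractions\<close>

text \<open>
  As usual in a commutative ring, \<open>f / g\<close> is the product of \<open>f\<close> with the multiplicative
  inverse of \<open>g\<close>; it is meaningful when \<open>g\<close> is a unit. The lemmas below show
  that the inverses of \<open>x\<^sub>i\<close>, \<open>1 - x\<^sub>i\<close> and \<open>1 - x\<^sub>i x\<^sub>j\<close> in this ring are
  \<open>x\<^sub>i\<^sup>-\<^sup>1\<close> and the geometric series.
\<close>

instantiation mls :: (comm_ring_1) inverse
begin

definition inverse_mls :: "'a mls \<Rightarrow> 'a mls" where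
  "inverse (f :: 'a mls) = (if f dvd 1 then THE g. f * g = 1 else 0)"

definition divide_mls :: "'a mls \<Rightarrow> 'a mls \<Rightarrow> 'a mls" where
  "(f :: 'a mls) div g = f * inverse g"

instance ..

end

lemma inverse_mls_unique:
  fixes f g :: "'a::comm_ring_1 mls"
  assumes "f * g = 1"
  shows "inverse f = g"
proof -
  have "(THE g. f * g = 1) = g"
  proof (rule the_equality)
    fix h assume "f * h = 1"
    have "h = h * (f * g)" by (simp add: assms)
    also have "\<dots> = (f * h) * g" by (simp add: ac_simps)
    finally show "h = g" using \<open>f * h = 1\<close> by simp
  qed (rule assms)
  moreover have "f dvd 1" using assms by (intro dvdI[of _ _ g]) simp
  ultimately show ?thesis by (simp add: inverse_mls_def)
qed

lemma inverse_mls_mult: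
  fixes f g :: "'a::comm_ring_1 mls"
  assumes "f dvd 1" "g dvd 1"
  shows "inverse (f * g) = inverse f * inverse g"
proof -
  obtain f' g' where "1 = f * f'" "1 = g * g'" using assms by (auto elim!: dvdE)
  then have "f * f' = 1" "g * g' = 1" by simp_all
  moreover have "(f * g) * (f' * g') = (f * f') * (g * g')" by (simp only: ac_simps)
  ultimately show ?thesis by (simp add: inverse_mls_unique)
qed

definition var_mls :: "nat \<Rightarrow> 'a::comm_ring_1 mls" where
  "var_mls i = monom_mls (Poly_Mapping.single i 1) 1"

definition CT_mls :: "'a::zero mls \<Rightarrow> 'a" where
  "CT_mls f = coeff_mls f 0"

lemma inverse_var_mls: "inverse (var_mls i) = monom_mls (Poly_Mapping.single i (- 1)) 1"
  by (rule inverse_mls_unique)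
     (simp add: var_mls_def monom_mult_monom one_mls_def flip: single_add)

text \<open>The geometric series \<open>\<Sum>\<^sub>k x\<^sup>k\<^sup>e\<close> for an exponent vector \<open>e \<ge> 0\<close>.\<close>

definition geom_mls :: "(nat \<Rightarrow>\<^sub>0 nat) \<Rightarrow> 'a::zero_neq_one mls" where
  "geom_mls e = Abs_mls (\<lambda>c.
     if \<exists>k. \<forall>i. Poly_Mapping.lookup c i = int (k * Poly_Mapping.lookup e i) then 1 else 0)"

lemma coeff_geom:
  "coeff_mls (geom_mls e) = (\<lambda>c.
     if \<exists>k. \<forall>i. Poly_Mapping.lookup c i = int (k * Poly_Mapping.lookup e i) then 1 else 0)"
  unfolding geom_mls_def
proof (rule Abs_mls_inverse, rule CollectI, intro exI conjI)
  show "laurent_bd (Poly_Mapping.keys e) 0 (\<lambda>c.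
     if \<exists>k. \<forall>i. Poly_Mapping.lookup c i = int (k * Poly_Mapping.lookup e i) then 1 else 0)"
    by (auto simp: laurent_bd_def in_keys_iff)
qed simp

lemma one_minus_monom_mult_geom:
  assumes "e \<noteq> 0"
  shows "(1 - monom_mls (Poly_Mapping.map int e) 1) * geom_mls e = (1 :: 'a::comm_ring_1 mls)"
proof (rule mls_eqI)
  fix c :: expo
  let ?e = "Poly_Mapping.map int e"
  let ?P = "\<lambda>c k. \<forall>i. Poly_Mapping.lookup c i = int (k * Poly_Mapping.lookup e i)"
  have le: "Poly_Mapping.lookup ?e i = int (Poly_Mapping.lookup e i)" for i
    by (simp add: Poly_Mapping.map.rep_eq when_def)
  obtain i where i: "Poly_Mapping.lookup e i \<noteq> 0"
    using assms by (metis lookup_zero poly_mapping_eqI)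
  have step: "?P (c - ?e) k \<longleftrightarrow> ?P c (Suc k)" for k
    by (simp add: lookup_minus le algebra_simps)
  have c0: "?P c 0 \<longleftrightarrow> c = 0"
    by (auto intro: poly_mapping_eqI)
  have "\<not> ?P 0 (Suc k)" for k
  proof
    assume "?P 0 (Suc k)"
    then have "int (Suc k * Poly_Mapping.lookup e i) = 0" by (metis lookup_zero)
    with i show False by (simp only: of_nat_eq_0_iff mult_eq_0_iff) simp
  qed
  then have zero: "c = 0 \<Longrightarrow> \<not> (\<exists>k. ?P (c - ?e) k)"
    unfolding step by simp
  have "(\<exists>k. ?P c k) \<longleftrightarrow> ?P c 0 \<or> (\<exists>k. ?P c (Suc k))"
    by (rule iffI, erule exE, case_tac k) blast+
  then have "(\<exists>k. ?P c k) \<longleftrightarrow> c = 0 \<or> (\<exists>k. ?P (c - ?e) k)"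
    unfolding step c0 .
  with zero have "coeff_mls (geom_mls e) c - coeff_mls (geom_mls e) (c - ?e)
      = (if c = 0 then 1 else (0::'a))"
    unfolding coeff_geom by (cases "c = 0") simp_all
  then show "coeff_mls ((1 - monom_mls ?e 1) * geom_mls e) c = coeff_mls (1 :: 'a mls) c"
    by (simp add: left_diff_distrib coeff_mls_simps coeff_monom_times one_mls_def coeff_monom)
qed

lemma inverse_one_minus_monom:
  assumes "e \<noteq> 0"
  shows "inverse (1 - monom_mls (Poly_Mapping.map int e) 1) = (geom_mls e :: 'a::comm_ring_1 mls)"
  using one_minus_monom_mult_geom[OF assms] by (rule inverse_mls_unique)

lemma inverse_one_minus_var:
  "inverse (1 - var_mls i) = (geom_mls (Poly_Mapping.single i 1) :: 'a::comm_ring_1 mls)"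
proof -
  have map: "Poly_Mapping.map int (Poly_Mapping.single i 1) = Poly_Mapping.single i 1"
    by (rule poly_mapping_eqI) (simp add: Poly_Mapping.map.rep_eq lookup_single when_def)
  have "Poly_Mapping.single i (1::nat) \<noteq> 0"
    by (metis lookup_single_eq lookup_zero zero_neq_one)
  from inverse_one_minus_monom[OF this, where 'a = 'a] show ?thesis
    by (simp only: map var_mls_def)
qed

lemma inverse_one_minus_var_mult_var:
  "inverse (1 - var_mls i * var_mls j) =
     (geom_mls (Poly_Mapping.single i 1 + Poly_Mapping.single j 1) :: 'a::comm_ring_1 mls)"
proof -
  let ?e = "Poly_Mapping.single i 1 + Poly_Mapping.single j (1::nat)"
  have map: "Poly_Mapping.map int ?e = Poly_Mapping.single i 1 + Poly_Mapping.single j 1"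
    by (rule poly_mapping_eqI) (simp add: Poly_Mapping.map.rep_eq lookup_single lookup_add when_def)
  have "Poly_Mapping.lookup ?e i \<noteq> 0" by (simp add: lookup_add)
  then have "?e \<noteq> 0" by (metis lookup_zero)
  from inverse_one_minus_monom[OF this, where 'a = 'a] show ?thesis
    by (simp only: map var_mls_def monom_mult_monom)
qed

lemma one_minus_var_units:
  "1 - var_mls i dvd (1 :: 'a::comm_ring_1 mls)"
  "1 - var_mls i * var_mls j dvd (1 :: 'a mls)"
proof -
  have "geom_mls e \<noteq> (0 :: 'a mls)" for e
  proof
    assume "geom_mls e = (0 :: 'a mls)"
    then have "coeff_mls (geom_mls e) 0 = (0 :: 'a)" by (simp add: coeff_mls_simps)
    moreover have "coeff_mls (geom_mls e) 0 = (1 :: 'a)"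
      unfolding coeff_geom by (auto intro: exI[of _ 0])
    ultimately show False by simp
  qed
  then show "1 - var_mls i dvd (1 :: 'a mls)" "1 - var_mls i * var_mls j dvd (1 :: 'a mls)"
    using inverse_one_minus_var[of i, where 'a = 'a]
      inverse_one_minus_var_mult_var[of i j, where 'a = 'a]
    unfolding inverse_mls_def by (metis, metis)
qed


section \<open>The two sides of the identity\<close>

definition g_fun :: "'a::comm_ring_1 \<Rightarrow> 'a" where
  "g_fun x = x * (1 + x)"

definition L_const :: "nat \<Rightarrow> nat \<Rightarrow> rat" where
  "L_const n m =
     (let x = (var_mls :: nat \<Rightarrow> rat mls) in
      1 / fact n * CT_mls
        (((\<Prod>r\<in>{1..n}. (1 + inverse (x r)) ^ m) *
          (\<Prod>(i, j)\<in>{(i, j). 1 \<le> i \<and> i < j \<and> j \<le> n}.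
             (x i - x j) * (g_fun (inverse (x i)) - g_fun (inverse (x j)))))
         / ((\<Prod>i\<in>{1..n}. 1 - x i) *
            (\<Prod>(i, j)\<in>{(i, j). 1 \<le> i \<and> i < j \<and> j \<le> n}. 1 - x i * x j))))"

definition z_lp :: "rat fls" where
  "z_lp = fls_X + 2 + inverse fls_X"

text \<open>
  Matrices of the library are indexed from \<open>0\<close>; \<open>det_ct k a\<close> is
  \<open>det (CT\<^sub>x (a i j))\<close> with \<open>1 \<le> i, j \<le> k\<close>.
\<close>

definition det_ct :: "nat \<Rightarrow> (nat \<Rightarrow> nat \<Rightarrow> rat fls) \<Rightarrow> rat" where
  "det_ct k a = det (mat k k (\<lambda>(i, j). fls_nth (a (i + 1) (j + 1)) 0))"

end

theory Submission
  imports Defs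
begin

text \<open>
  By Schur's Pfaffian, \<open>\<Prod>\<^sub>i\<^sub><\<^sub>j (x\<^sub>i - x\<^sub>j) / (1 - x\<^sub>i x\<^sub>j)\<close> is up to a constant the antisymmetrization of a
  product over disjoint pairs of variables. Expanding the Vandermonde product in the
  \<open>g(1/x\<^sub>i)\<close> as well, the constant term factors over these pairs, and with
  \<open>(x - y) / ((1 - x y)(1 - x)(1 - y)) = \<Sum> sgn(a - b) x\<^sup>a y\<^sup>b\<close> each pair contributes
  \<open>M(z\<^sup>m g(u)\<^sup>a g(1/u)\<^sup>b)\<close>, where \<open>M(f) = \<Sum>\<^sub>e sgn(e) [u\<^sup>e] f\<close> is a linear functional on Laurent polynomials in
  one variable; for odd \<open>n\<close> the unpaired variable contributes \<open>2\<^sup>m g(1)\<^sup>c = 2\<^sup>m\<^sup>+\<^sup>c\<close>.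

  So \<open>M\<close> is applied in each of \<open>k\<close> variables \<open>u\<^sub>i\<close> to the Vandermonde product of the numbers
  \<open>g(u\<^sub>i), g(1/u\<^sub>i)\<close> (and \<open>2\<close>, if \<open>n\<close> is odd). Since \<open>g(u) + g(1/u) = z\<^sup>2 - 3z\<close> and \<open>g(u) g(1/u) = z\<close>, this
  product equals \<open>\<Prod>\<^sub>i (g(u\<^sub>i) - g(1/u\<^sub>i)) \<cdot> \<Prod>\<^sub>i\<^sub><\<^sub>j (z\<^sub>i - z\<^sub>j)(w\<^sub>i - w\<^sub>j) z\<^sub>i z\<^sub>j\<close> with \<open>w = (z - 1)\<^sup>3 / z\<close>, times
  \<open>\<Prod>\<^sub>i (2z\<^sub>i + 1)(4 - z\<^sub>i)\<close> for odd \<open>n\<close>. As \<open>M((g(u) - g(1/u)) \<phi>) = CT z (z - 1) \<phi>\<close>, expanding the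
  two Vandermonde products in \<open>z\<close> and \<open>w\<close> yields \<open>k!\<close> times the determinant.
\<close>

section \<open>Multivariate Laurent series form an integral domain\<close>

lemma mls_bd: "\<exists>V N. finite V \<and> 0 \<le> N \<and> laurent_bd V N (coeff_mls f)"
proof -
  have "\<exists>V N. finite V \<and> laurent_bd V N (coeff_mls f)" using coeff_mls[of f] by simp
  from laurent_bd_common[OF this this] show ?thesis by metis
qed

definition tdeg :: "expo \<Rightarrow> int" where
  "tdeg e = (\<Sum>i\<in>Poly_Mapping.keys e. Poly_Mapping.lookup e i)"

lemma tdeg_superset:
  assumes "finite V" "Poly_Mapping.keys e \<subseteq> V"
  shows "tdeg e = (\<Sum>i\<in>V. Poly_Mapping.lookup e i)"
  unfolding tdeg_def by (rule sum.mono_neutral_left) (use assms in \<open>auto simp: in_keys_iff\<close>)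

lemma tdeg_add: "tdeg (a + b) = tdeg a + tdeg b"
proof -
  let ?V = "Poly_Mapping.keys a \<union> Poly_Mapping.keys b"
  have "Poly_Mapping.keys (a + b) \<subseteq> ?V" by (rule keys_add)
  then show ?thesis
    by (simp add: tdeg_superset[of ?V] lookup_add sum.distrib)
qed

text \<open>On the support the total degree is bounded below, because finitely many variables occur
  and all exponents are at least \<open>- N\<close>. In the lowest degree only finitely many
  exponent vectors remain, and the linear order on them breaks ties.\<close>

lemma mls_leading_term:
  fixes f :: "'a::comm_ring_1 mls"
  assumes "f \<noteq> 0"
  obtains a where "coeff_mls f a \<noteq> 0"
    "\<And>b. coeff_mls f b \<noteq> 0 \<Longrightarrow> tdeg a < tdeg b \<or> tdeg a = tdeg b \<and> a \<le> b"
proof -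
  obtain V N where V: "finite V" "0 \<le> N" "laurent_bd V N (coeff_mls f)"
    using mls_bd by blast
  have sub: "Poly_Mapping.keys e \<subseteq> V" "- N \<le> Poly_Mapping.lookup e i" if "coeff_mls f e \<noteq> 0" for e i
    using V(3) that by (auto simp: laurent_bd_def)
  have ge: "- N * int (card V) \<le> tdeg e" if "coeff_mls f e \<noteq> 0" for e
    using sum_mono[of V "\<lambda>_. - N" "Poly_Mapping.lookup e"] sub[OF that]
    by (simp add: tdeg_superset[OF V(1) sub(1)[OF that]] mult.commute)
  \<comment> \<open>The shift by \<open>N * int (card V)\<close> makes degrees non-negative on the
    support, so that a least one exists.\<close>
  let ?D = "\<lambda>e. nat (tdeg e + N * int (card V))"
  obtain e0 where e0: "coeff_mls f e0 \<noteq> 0"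
    using assms by (metis coeff_mls_simps(1) mls_eqI)
  obtain d where d: "coeff_mls f d \<noteq> 0" "\<And>b. coeff_mls f b \<noteq> 0 \<Longrightarrow> ?D d \<le> ?D b"
    using ex_has_least_nat[of "\<lambda>e. coeff_mls f e \<noteq> 0" e0 ?D] e0 by blast
  have dle: "tdeg d \<le> tdeg b" if "coeff_mls f b \<noteq> 0" for b
    using d(2)[OF that] ge[OF that] ge[OF d(1)] by simp
  let ?S = "{e. coeff_mls f e \<noteq> 0 \<and> tdeg e = tdeg d}"
  have "?S \<subseteq> expo_box V (\<bar>tdeg d\<bar> + N * int (card V) + N)"
  proof
    fix e assume e: "e \<in> ?S"
    then have nz: "coeff_mls f e \<noteq> 0" by simp
    have "\<bar>Poly_Mapping.lookup e i\<bar> \<le> \<bar>tdeg d\<bar> + N * int (card V) + N" for i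
    proof (cases "i \<in> V")
      case True
      \<comment> \<open>All shifted exponents are non-negative, so each is at most their
        sum.\<close>
      have "(\<Sum>j\<in>V. Poly_Mapping.lookup e j + N) \<ge> Poly_Mapping.lookup e i + N"
        using member_le_sum[of i V "\<lambda>j. Poly_Mapping.lookup e j + N"] sub(2)[OF nz] V True
        by (smt (verit) DiffD1)
      then have "Poly_Mapping.lookup e i + N \<le> tdeg e + N * int (card V)"
        using tdeg_superset[OF V(1) sub(1)[OF nz]] by (simp add: sum.distrib mult.commute)
      moreover have "tdeg e = tdeg d" using e by simp
      moreover have "0 \<le> N * int (card V)" using V by simp
      ultimately show ?thesis using sub(2)[OF nz, of i] V(2) by linarith
    next
      case False
      then have "Poly_Mapping.lookup e i = 0" using sub(1)[OF nz] by (auto simp: in_keys_iff)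
      then show ?thesis using V(2) by simp
    qed
    then show "e \<in> expo_box V (\<bar>tdeg d\<bar> + N * int (card V) + N)"
      using sub(1)[OF nz] by (simp add: expo_box_def)
  qed
  then have fin: "finite ?S" using finite_expo_box[OF V(1)] finite_subset by blast
  have ne: "?S \<noteq> {}" using d by blast
  show thesis
  proof (rule that[of "Min ?S"])
    have m: "Min ?S \<in> ?S" using fin ne by (rule Min_in)
    then show "coeff_mls f (Min ?S) \<noteq> 0" by simp
    fix b assume b: "coeff_mls f b \<noteq> 0"
    show "tdeg (Min ?S) < tdeg b \<or> tdeg (Min ?S) = tdeg b \<and> Min ?S \<le> b"
    proof (cases "tdeg b = tdeg d")
      case True
      then have "Min ?S \<le> b" using fin b by (intro Min_le) auto
      then show ?thesis using m True by auto
    next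
      case False
      then show ?thesis using dle[OF b] m by auto
    qed
  qed
qed

text \<open>Total degree and the order on exponent vectors are compatible with addition, so the
  minimal exponents \<open>a\<close> and \<open>b\<close> give the only contribution at
  \<open>a + b\<close>. The interpolation arguments below need the absence of zero divisors.\<close>

instance mls :: (idom) idom
proof
  fix f g :: "'a mls"
  assume "f \<noteq> 0" "g \<noteq> 0"
  obtain a where a: "coeff_mls f a \<noteq> 0"
    "\<And>b. coeff_mls f b \<noteq> 0 \<Longrightarrow> tdeg a < tdeg b \<or> tdeg a = tdeg b \<and> a \<le> b"
    using mls_leading_term[OF \<open>f \<noteq> 0\<close>] by blast
  obtain b where b: "coeff_mls g b \<noteq> 0"
    "\<And>c. coeff_mls g c \<noteq> 0 \<Longrightarrow> tdeg b < tdeg c \<or> tdeg b = tdeg c \<and> b \<le> c"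
    using mls_leading_term[OF \<open>g \<noteq> 0\<close>] by blast
  have "a' = a" if "coeff_mls f a' \<noteq> 0" "coeff_mls g (a + b - a') \<noteq> 0" for a'
  proof -
    let ?b = "a + b - a'"
    have eq: "a + b = a' + ?b" by simp
    have "tdeg a + tdeg b = tdeg a' + tdeg ?b" by (metis eq tdeg_add)
    then have "a \<le> a'" "b \<le> ?b" using a(2)[OF that(1)] b(2)[OF that(2)] by linarith+
    then show ?thesis using eq by (metis add_le_cancel_left add_le_cancel_right add.commute antisym)
  qed
  then have "coeff_mls (f * g) (a + b) = coeff_mls f a * coeff_mls g b"
    unfolding times_mls.rep_eq by (subst conv_eq_sum[where A = "{a}"]) auto
  then have "coeff_mls (f * g) (a + b) \<noteq> 0" using a(1) b(1) by simp
  then show "f * g \<noteq> 0" by (auto simp: coeff_mls_simps)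
qed

lemma coeff_of_nat_mls: "coeff_mls (of_nat n :: 'a::comm_ring_1 mls) 0 = of_nat n"
  by (induction n) (simp_all add: coeff_mls_simps one_mls_def coeff_monom)

instance mls :: ("{comm_ring_1,ring_char_0}") ring_char_0
  by standard (metis coeff_of_nat_mls injI of_nat_eq_iff)

section \<open>Alternating sums over permutations\<close>

text \<open>Each root splits off a linear factor, and the degree bound leaves a constant. The
  Vandermonde determinant and Schur's Pfaffian both arise from this in the last variable; they
  differ in how \<open>C\<close> is found.\<close>

lemma poly_vanishing_form:
  fixes p :: "'a::idom poly"
  assumes "degree p \<le> n" "inj_on x {..<n}" "\<And>j. j < n \<Longrightarrow> poly p (x j) = 0"
  shows "\<exists>C. p = Polynomial.smult C (\<Prod>j<n. [:- x j, 1:])"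
  using assms
proof (induction n arbitrary: p)
  case 0
  then show ?case by (auto elim: degree_eq_zeroE)
next
  case (Suc n)
  have "[:- x n, 1:] dvd p" using Suc.prems(3)[of n] by (simp add: poly_eq_0_iff_dvd)
  then obtain q where q: "p = [:- x n, 1:] * q" by blast
  have "degree q \<le> n"
  proof (cases "q = 0")
    case False
    then have "degree p = degree q + 1" unfolding q by (subst degree_mult_eq) auto
    then show ?thesis using Suc.prems(1) by simp
  qed simp
  moreover have "inj_on x {..<n}" using Suc.prems(2) by (rule inj_on_subset) auto
  moreover have "poly q (x j) = 0" if "j < n" for j
  proof -
    have "(x j - x n) * poly q (x j) = 0"
      using Suc.prems(3)[of j] that by (simp add: q algebra_simps)
    moreover have "x j \<noteq> x n" using Suc.prems(2) that by (auto simp: inj_on_def)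
    ultimately show ?thesis by simp
  qed
  ultimately obtain C where "q = Polynomial.smult C (\<Prod>j<n. [:- x j, 1:])" using Suc.IH by blast
  then show ?case by (intro exI[of _ C]) (simp add: q ac_simps)
qed

text \<open>Substitution of \<open>\<tau> \<circ> \<pi>\<close> for \<open>\<tau>\<close>; the
  predicate \<open>P\<close> lets it act on sums over permutations with a prescribed value at some
  position.\<close>

lemma perm_sum_compose:
  fixes F :: "('b \<Rightarrow> 'b) \<Rightarrow> 'a::comm_ring_1"
  assumes "finite S" "\<pi> permutes S"
  shows "(\<Sum>\<tau> | \<tau> permutes S \<and> P \<tau>. of_int (sign \<tau>) * F \<tau>) =
    of_int (sign \<pi>) * (\<Sum>\<tau> | \<tau> permutes S \<and> P (\<tau> \<circ> \<pi>). of_int (sign \<tau>) * F (\<tau> \<circ> \<pi>))"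
proof -
  have sgn: "of_int (sign (\<tau> \<circ> \<pi>)) = of_int (sign \<pi>) * (of_int (sign \<tau>) :: 'a)" if "\<tau> permutes S" for \<tau>
    using that assms by (simp add: sign_compose permutes_imp_permutation[OF assms(1)])
  have "(\<Sum>\<tau> | \<tau> permutes S \<and> P \<tau>. of_int (sign \<tau>) * F \<tau>) =
      (\<Sum>\<tau> | \<tau> permutes S \<and> P (\<tau> \<circ> \<pi>). of_int (sign (\<tau> \<circ> \<pi>)) * F (\<tau> \<circ> \<pi>))"
    by (rule sum.reindex_bij_witness[of _ "\<lambda>\<tau>. \<tau> \<circ> \<pi>" "\<lambda>\<tau>. \<tau> \<circ> inv_into UNIV \<pi>"])
       (use assms in \<open>auto simp: comp_assoc permutes_inv_o permutes_compose permutes_inv\<close>)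
  also have "\<dots> = (\<Sum>\<tau> | \<tau> permutes S \<and> P (\<tau> \<circ> \<pi>). of_int (sign \<pi>) * (of_int (sign \<tau>) * F (\<tau> \<circ> \<pi>)))"
    by (rule sum.cong) (auto simp: sgn mult.assoc)
  finally show ?thesis by (simp add: sum_distrib_left)
qed

text \<open>Swapping two positions is a sign-reversing involution on the summands, so the sum equals
  its own negative.\<close>

lemma perm_sum_cancel:
  fixes F :: "('b \<Rightarrow> 'b) \<Rightarrow> 'a::{idom,ring_char_0}"
  assumes "finite S" "i \<in> S" "j \<in> S" "i \<noteq> j"
    and "\<And>\<tau>. \<tau> permutes S \<Longrightarrow> P \<tau> \<Longrightarrow> P (\<tau> \<circ> transpose i j) \<and> F (\<tau> \<circ> transpose i j) = F \<tau>"
  shows "(\<Sum>\<tau> | \<tau> permutes S \<and> P \<tau>. of_int (sign \<tau>) * F \<tau>) = 0"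
proof -
  let ?\<pi> = "transpose i j"
  have \<pi>: "?\<pi> permutes S" using assms by (simp add: permutes_swap_id)
  have P: "P (\<tau> \<circ> ?\<pi>) \<longleftrightarrow> P \<tau>" if "\<tau> permutes S" for \<tau>
    using assms(5)[of "\<tau>"] assms(5)[of "\<tau> \<circ> ?\<pi>"] that \<pi>
    by (auto simp: comp_assoc permutes_compose)
  have "(\<Sum>\<tau> | \<tau> permutes S \<and> P \<tau>. of_int (sign \<tau>) * F \<tau>) =
      - (\<Sum>\<tau> | \<tau> permutes S \<and> P (\<tau> \<circ> ?\<pi>). of_int (sign \<tau>) * F (\<tau> \<circ> ?\<pi>))"
    using perm_sum_compose[OF assms(1) \<pi>, where P = P and F = F] assms(4) by (simp add: sign_swap_id)
  also have "(\<Sum>\<tau> | \<tau> permutes S \<and> P (\<tau> \<circ> ?\<pi>). of_int (sign \<tau>) * F (\<tau> \<circ> ?\<pi>))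
     = (\<Sum>\<tau> | \<tau> permutes S \<and> P \<tau>. of_int (sign \<tau>) * F \<tau>)"
    by (rule sum.cong) (auto simp: P assms(5))
  finally show ?thesis by simp
qed

text \<open>Here the swap acts on the left, on labels instead of positions; \<open>x\<close> does
  not see it because both labels carry the same element.\<close>

lemma perm_sum_cancel_left:
  fixes x :: "'b \<Rightarrow> 'c" and F :: "('b \<Rightarrow> 'c) \<Rightarrow> 'a::{idom,ring_char_0}"
  assumes "finite S" "i \<in> S" "j \<in> S" "i \<noteq> j" "x i = x j"
  shows "(\<Sum>\<tau> | \<tau> permutes S. of_int (sign \<tau>) * F (x \<circ> \<tau>)) = 0"
proof -
  let ?\<pi> = "transpose i j"
  have \<pi>: "?\<pi> permutes S" using assms by (simp add: permutes_swap_id)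
  have sgn: "of_int (sign (?\<pi> \<circ> \<tau>)) = - (of_int (sign \<tau>) :: 'a)" if "\<tau> permutes S" for \<tau>
    using that assms \<pi> by (simp add: sign_compose permutes_imp_permutation[OF assms(1)] sign_swap_id)
  have x: "x \<circ> (?\<pi> \<circ> \<tau>) = x \<circ> \<tau>" for \<tau>
    using assms(5) by (auto simp: fun_eq_iff transpose_def)
  have "(\<Sum>\<tau> | \<tau> permutes S. of_int (sign \<tau>) * F (x \<circ> \<tau>))
     = (\<Sum>\<tau> | \<tau> permutes S. of_int (sign (?\<pi> \<circ> \<tau>)) * F (x \<circ> (?\<pi> \<circ> \<tau>)))"
    by (rule sum.reindex_bij_witness[of _ "\<lambda>\<tau>. ?\<pi> \<circ> \<tau>" "\<lambda>\<tau>. ?\<pi> \<circ> \<tau>"])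
       (use \<pi> in \<open>auto simp: permutes_compose simp flip: comp_assoc\<close>)
  also have "\<dots> = (\<Sum>\<tau> | \<tau> permutes S. - (of_int (sign \<tau>) * F (x \<circ> \<tau>)))"
    by (rule sum.cong) (auto simp: sgn x simp del: comp_apply)
  finally show ?thesis by (simp add: sum_negf)
qed

lemma permutes_lessThan_Suc_fix:
  "{\<tau>. \<tau> permutes {..<Suc n} \<and> \<tau> n = n} = {\<tau>. \<tau> permutes {..<n}}"
proof -
  have "\<tau> permutes {..<n}" if "\<tau> permutes {..<Suc n}" "\<tau> n = n" for \<tau>
    by (rule permutes_superset[OF that(1)]) (use that(2) in \<open>auto simp: less_Suc_eq\<close>)
  moreover have "\<tau> permutes {..<Suc n} \<and> \<tau> n = n" if "\<tau> permutes {..<n}" for \<tau>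
    using permutes_subset[OF that, of "{..<Suc n}"] permutes_not_in[OF that] by auto
  ultimately show ?thesis by blast
qed

section \<open>The Vandermonde determinant\<close>

definition diff_prod :: "nat \<Rightarrow> (nat \<Rightarrow> 'a::comm_ring_1) \<Rightarrow> 'a" where
  "diff_prod n y = (\<Prod>j<n. \<Prod>i<j. y i - y j)"

text \<open>The Leibniz expansion of the determinant with entries \<open>y i ^ j\<close>.\<close>

definition alt_powers :: "nat \<Rightarrow> (nat \<Rightarrow> 'a::comm_ring_1) \<Rightarrow> 'a" where
  "alt_powers n y = (\<Sum>\<sigma> | \<sigma> permutes {..<n}. of_int (sign \<sigma>) * (\<Prod>i<n. y i ^ \<sigma> i))"

lemma alt_powers_eq_0:
  fixes y :: "nat \<Rightarrow> 'a::{idom,ring_char_0}"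
  assumes "i < n" "j < n" "i \<noteq> j" "y i = y j"
  shows "alt_powers n y = 0"
proof -
  have "(\<Sum>\<sigma> | \<sigma> permutes {..<n} \<and> True. of_int (sign \<sigma>) * (\<Prod>i<n. y i ^ \<sigma> i)) = 0"
  proof (rule perm_sum_cancel[of _ i j])
    fix \<tau> :: "nat \<Rightarrow> nat"
    have \<pi>: "transpose i j permutes {..<n}" using assms by (simp add: permutes_swap_id)
    have y: "y (transpose i j l) = y l" for l using assms(4) by (auto simp: transpose_def)
    have "(\<Prod>l<n. y l ^ \<tau> l) = (\<Prod>l<n. y l ^ (\<tau> \<circ> transpose i j) l)"
      by (subst prod.permute[OF \<pi>]) (simp add: y)
    then show "True \<and> (\<Prod>l<n. y l ^ (\<tau> \<circ> transpose i j) l) = (\<Prod>l<n. y l ^ \<tau> l)" by simp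
  qed (use assms in auto)
  then show ?thesis by (simp add: alt_powers_def)
qed

lemma diff_prod_eq_0:
  assumes "i < n" "j < n" "i \<noteq> j" "y i = y j"
  shows "diff_prod n y = 0"
proof -
  have "diff_prod n y = 0" if "a < b" "b < n" "y a = y b" for a b
    unfolding diff_prod_def
    by (rule prod_zero[OF _ bexI[of _ b]], simp, rule prod_zero[OF _ bexI[of _ a]]) (use that in auto)
  then show ?thesis using assms by (metis linorder_neqE_nat)
qed

text \<open>In the last variable the alternant is a polynomial of degree at most \<open>n\<close>
  vanishing at the other points, with the smaller alternant as its coefficient of degree
  \<open>n\<close>. The signs come from turning \<open>y n - y j\<close> into
  \<open>y j - y n\<close>.\<close>

lemma alt_powers_eq:
  fixes y :: "nat \<Rightarrow> 'a::{idom,ring_char_0}"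
  shows "alt_powers n y = (\<Prod>j<n. (- 1) ^ j) * diff_prod n y"
proof (induction n arbitrary: y)
  case 0
  then show ?case by (simp add: alt_powers_def diff_prod_def)
next
  case (Suc n)
  show ?case
  proof (cases "inj_on y {..<n}")
    \<comment> \<open>With a repeated point both sides vanish; otherwise the \<open>n\<close> roots
      are distinct.\<close>
    case False
    then obtain i j where "i < n" "j < n" "i \<noteq> j" "y i = y j" by (auto simp: inj_on_def)
    then show ?thesis using alt_powers_eq_0[of i "Suc n" j y] diff_prod_eq_0[of i "Suc n" j y] by simp
  next
    case True
    define p where "p = (\<Sum>\<sigma> | \<sigma> permutes {..<Suc n}.
      monom (of_int (sign \<sigma>) * (\<Prod>i<n. y i ^ \<sigma> i)) (\<sigma> n))"
    have p: "poly p t = alt_powers (Suc n) (y(n := t))" for t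
      unfolding p_def alt_powers_def by (simp add: poly_sum poly_monom mult.assoc)
    have "degree p \<le> n" unfolding p_def
    proof (intro degree_sum_le order.trans[OF degree_monom_le])
      show "\<sigma> n \<le> n" if "\<sigma> \<in> {\<sigma>. \<sigma> permutes {..<Suc n}}" for \<sigma>
        using permutes_in_image[of \<sigma> "{..<Suc n}" n] that by auto
    qed (simp add: finite_permutations)
    moreover have "poly p (y j) = 0" if "j < n" for j
      unfolding p by (rule alt_powers_eq_0[of j _ n]) (use that in auto)
    ultimately obtain C where C: "p = Polynomial.smult C (\<Prod>j<n. [:- y j, 1:])"
      using poly_vanishing_form[OF _ True] by blast
    \<comment> \<open>Only permutations fixing \<open>n\<close> reach the exponent \<open>n\<close>
      in the last variable.\<close>
    have "coeff p n = (\<Sum>\<sigma> | \<sigma> permutes {..<Suc n}.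
      if \<sigma> n = n then of_int (sign \<sigma>) * (\<Prod>i<n. y i ^ \<sigma> i) else 0)"
      unfolding p_def by (simp add: coeff_sum)
    also have "\<dots> = alt_powers n y"
      unfolding alt_powers_def
      by (simp add: sum.inter_filter[symmetric] finite_permutations permutes_lessThan_Suc_fix)
    finally have "coeff p n = alt_powers n y" .
    moreover have "coeff p n = C"
    proof -
      have "degree (\<Prod>j<n. [:- y j, 1:]) = n" by (subst degree_prod_eq_sum_degree) auto
      moreover have "lead_coeff (\<Prod>j<n. [:- y j, 1:]) = 1" by (simp add: lead_coeff_prod)
      ultimately show ?thesis by (simp add: C)
    qed
    ultimately have "C = alt_powers n y" by simp
    have "alt_powers (Suc n) y = poly p (y n)" by (simp add: p)
    also have "\<dots> = C * (\<Prod>j<n. y n - y j)" by (simp add: C poly_prod)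
    also have "(\<Prod>j<n. y n - y j) = (\<Prod>j<n. (- 1) * (y j - y n))" by simp
    also have "\<dots> = (- 1) ^ n * (\<Prod>j<n. y j - y n)" by (subst prod.distrib) simp
    finally show ?thesis
      by (simp add: \<open>C = _\<close> Suc.IH diff_prod_def algebra_simps)
  qed
qed

section \<open>Schur's Pfaffian\<close>

text \<open>For \<open>n = 2k\<close> and antisymmetric \<open>f\<close> this is \<open>2\<^sup>k k!\<close> times the Pfaffian of \<open>f (x\<^sub>i) (x\<^sub>j)\<close>.\<close>

definition alt_pairs :: "('a \<Rightarrow> 'a \<Rightarrow> 'a::comm_ring_1) \<Rightarrow> nat \<Rightarrow> (nat \<Rightarrow> 'a) \<Rightarrow> 'a" where
  "alt_pairs f n x = (\<Sum>\<tau> | \<tau> permutes {..<n}. of_int (sign \<tau>) *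
     (\<Prod>i<n div 2. f (x (\<tau> (2 * i))) (x (\<tau> (2 * i + 1)))))"

lemma sum_permutes_Suc_split:
  "(\<Sum>\<tau> | \<tau> permutes {..<Suc n}. f \<tau>) = (\<Sum>p<Suc n. \<Sum>\<tau> | \<tau> permutes {..<Suc n} \<and> \<tau> p = n. f \<tau>)"
proof -
  have "(\<Sum>\<tau> | \<tau> permutes {..<Suc n}. f \<tau>)
     = (\<Sum>p<Suc n. \<Sum>\<tau> | \<tau> \<in> {\<tau>. \<tau> permutes {..<Suc n}} \<and> inv_into UNIV \<tau> n = p. f \<tau>)"
    by (rule sum.group[symmetric])
       (auto simp: finite_permutations permutes_inv permutes_in_image simp flip: lessThan_iff
         simp del: lessThan_Suc)
  also have "\<dots> = (\<Sum>p<Suc n. \<Sum>\<tau> | \<tau> permutes {..<Suc n} \<and> \<tau> p = n. f \<tau>)"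
    by (intro sum.cong refl) (auto simp: permutes_inv_eq permutes_inverses)
  finally show ?thesis .
qed

lemma odd_neq_even:
  fixes b c :: nat
  shows "2 * b + 1 \<noteq> 2 * c" "2 * c \<noteq> 2 * b + 1"
  by presburger+

locale schur =
  fixes X :: "'a::{idom,ring_char_0} set" and iv :: "'a \<Rightarrow> 'a"
  assumes iv: "\<And>x y. x \<in> X \<Longrightarrow> y \<in> X \<Longrightarrow> (1 - x * y) * iv (1 - x * y) = 1"
    and iv1: "\<And>x. x \<in> X \<Longrightarrow> (1 - x) * iv (1 - x) = 1"
begin

definition squot :: "'a \<Rightarrow> 'a \<Rightarrow> 'a" where
  "squot x y = (x - y) * iv (1 - x * y)"

lemma squot_antisym: "squot y x = - squot x y"
  by (simp add: squot_def mult.commute[of y x] algebra_simps)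

text \<open>At 1 a factor loses its dependence on the other variable; this makes 1 the point where
  \<open>n + 1\<close> variables reduce to \<open>n\<close>.\<close>

lemma squot_1: "x \<in> X \<Longrightarrow> squot x 1 = - 1" "x \<in> X \<Longrightarrow> squot 1 x = 1"
proof -
  assume x: "x \<in> X"
  have "squot x 1 = - ((1 - x) * iv (1 - x))" by (simp add: squot_def algebra_simps)
  then show "squot x 1 = - 1" using iv1[OF x] by simp
  then show "squot 1 x = 1" using squot_antisym[of x 1] by simp
qed

lemma squot_mult: "x \<in> X \<Longrightarrow> t \<in> insert 1 X \<Longrightarrow> squot t x * (1 - t * x) = t - x"
  using iv[of t x] iv1[of x] by (auto simp: squot_def mult.assoc mult.left_commute mult.commute)

text \<open>A variable occurs in at most one pair, hence \<open>t\<close> in at most one factor.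
  Antisymmetry moves it to the first argument, with the sign absorbed in \<open>c\<close>.\<close>

lemma pair_prod_upd:
  assumes "\<tau> permutes {..<Suc n}"
  shows "\<exists>c j. (\<forall>t. (\<Prod>i<Suc n div 2. squot ((x(n := t)) (\<tau> (2 * i))) ((x(n := t)) (\<tau> (2 * i + 1)))) = c) \<or>
      j < n \<and> (\<forall>t. (\<Prod>i<Suc n div 2. squot ((x(n := t)) (\<tau> (2 * i))) ((x(n := t)) (\<tau> (2 * i + 1)))) = c * squot t (x j))"
proof -
  let ?f = "\<lambda>t i. squot ((x(n := t)) (\<tau> (2 * i))) ((x(n := t)) (\<tau> (2 * i + 1)))"
  let ?K = "Suc n div 2"
  have lt: "\<tau> i < Suc n" if "i < Suc n" for i
    using permutes_in_image[OF assms, of i] that by simp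
  define p where "p = inv_into UNIV \<tau> n"
  have p: "\<tau> i = n \<longleftrightarrow> i = p" for i unfolding p_def using assms
    by (metis permutes_inv_eq)
  \<comment> \<open>The pair containing the slot of \<open>t\<close>; \<open>i0 < ?K\<close> fails
    exactly if this slot is the unpaired last one.\<close>
  define i0 where "i0 = p div 2"
  have const: "?f t i = squot (x (\<tau> (2 * i))) (x (\<tau> (2 * i + 1)))" if "i \<noteq> i0" for t i
  proof -
    have "2 * i \<noteq> p" "2 * i + 1 \<noteq> p" using that by (auto simp: i0_def)
    then show ?thesis by (simp add: p[symmetric])
  qed
  show ?thesis
  proof (cases "i0 < ?K")
    case False
    then have "(\<Prod>i<?K. ?f t i) = (\<Prod>i<?K. squot (x (\<tau> (2 * i))) (x (\<tau> (2 * i + 1))))" for t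
      by (intro prod.cong const) auto
    then show ?thesis by blast
  next
    case True
    define c where "c = (\<Prod>i\<in>{..<?K} - {i0}. squot (x (\<tau> (2 * i))) (x (\<tau> (2 * i + 1))))"
    have split: "(\<Prod>i<?K. ?f t i) = ?f t i0 * c" for t
    proof -
      have "(\<Prod>i<?K. ?f t i) = ?f t i0 * (\<Prod>i\<in>{..<?K} - {i0}. ?f t i)"
        by (rule prod.remove) (use True in auto)
      also have "(\<Prod>i\<in>{..<?K} - {i0}. ?f t i) = c"
        unfolding c_def by (intro prod.cong refl const) auto
      finally show ?thesis .
    qed
    show ?thesis
    proof (cases "p = 2 * i0")
      case even: True
      define j where "j = \<tau> (2 * i0 + 1)"
      have "j \<noteq> n" using p[of "2 * i0 + 1"] even by (simp add: j_def)
      moreover have "j < Suc n" unfolding j_def using True by (intro lt) linarith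
      ultimately have j: "j < n" by simp
      have "\<tau> (2 * i0) = n" using p even by simp
      then have "?f t i0 = squot t (x j)" for t using j by (simp add: j_def)
      then show ?thesis using j by (intro exI[of _ c] exI[of _ j] disjI2) (simp only: split mult.commute[of c] simp_thms)
    next
      case False
      then have odd: "p = 2 * i0 + 1" by (auto simp: i0_def elim: oddE)
      define j where "j = \<tau> (2 * i0)"
      have "j \<noteq> n" using p[of "2 * i0"] odd by (simp add: j_def)
      moreover have "j < Suc n" unfolding j_def using True by (intro lt) linarith
      ultimately have j: "j < n" by simp
      have "\<tau> (2 * i0 + 1) = n" using p odd by simp
      then have "?f t i0 = - squot t (x j)" for t using j squot_antisym[of t "x j"] by (simp add: j_def)
      then show ?thesis using j by (intro exI[of _ "- c"] exI[of _ j] disjI2) (simp only: split minus_mult_commute mult.commute[of _ c] simp_thms)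
    qed
  qed
qed

text \<open>Each summand has at most one denominator \<open>1 - t * x j\<close>. The product over
  all \<open>j\<close> clears it, and the numerator \<open>t - x j\<close> takes its place, so the
  degree stays at most \<open>n\<close>. The point 1 is included because the polynomial is evaluated
  there later.\<close>

lemma alt_pairs_poly:
  assumes "\<And>j. j < n \<Longrightarrow> x j \<in> X"
  shows "\<exists>p. degree p \<le> n \<and> (\<forall>t\<in>insert 1 X.
    alt_pairs squot (Suc n) (x(n := t)) * (\<Prod>j<n. 1 - t * x j) = poly p t)"
proof -
  let ?F = "\<lambda>\<tau> t. \<Prod>i<Suc n div 2. squot ((x(n := t)) (\<tau> (2 * i))) ((x(n := t)) (\<tau> (2 * i + 1)))"
  have deg: "degree (\<Prod>j\<in>A. [:1, - x j:]) \<le> card A" for A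
  proof (cases "finite A")
    case True
    have "degree (\<Prod>j\<in>A. [:1, - x j:]) \<le> (\<Sum>j\<in>A. 1)"
      by (rule order.trans[OF degree_prod_sum_le[OF True]], rule sum_mono) simp
    then show ?thesis by simp
  qed simp
  have ex: "\<exists>p. degree p \<le> n \<and> (\<forall>t\<in>insert 1 X. ?F \<tau> t * (\<Prod>j<n. 1 - t * x j) = poly p t)"
    if \<tau>: "\<tau> permutes {..<Suc n}" for \<tau>
  proof -
    obtain c j where "(\<forall>t. ?F \<tau> t = c) \<or> j < n \<and> (\<forall>t. ?F \<tau> t = c * squot t (x j))"
      using pair_prod_upd[OF \<tau>, of x] by (elim exE) (rule that)
    then consider "\<And>t. ?F \<tau> t = c" | "j < n" "\<And>t. ?F \<tau> t = c * squot t (x j)"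
      by (elim disjE conjE) (simp_all only: simp_thms)
    then show ?thesis
    proof cases
      case 1
      have "degree (Polynomial.smult c (\<Prod>j<n. [:1, - x j:])) \<le> n"
        using deg[of "{..<n}"] degree_smult_le order.trans by fastforce
      then show ?thesis
        by (intro exI[of _ "Polynomial.smult c (\<Prod>j<n. [:1, - x j:])"]) (simp only: 1 poly_smult poly_prod, simp)
    next
      case 2
      let ?q = "\<Prod>i\<in>{..<n} - {j}. [:1, - x i:]"
      have "degree ([:- x j, 1:] * ?q) \<le> 1 + (n - 1)"
        using deg[of "{..<n} - {j}"] 2(1) by (intro order.trans[OF degree_mult_le] add_mono) auto
      then have d: "degree (Polynomial.smult c ([:- x j, 1:] * ?q)) \<le> n"
        using 2(1) degree_smult_le[of c "[:- x j, 1:] * ?q"] by simp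
      have "?F \<tau> t * (\<Prod>j<n. 1 - t * x j) = poly (Polynomial.smult c ([:- x j, 1:] * ?q)) t"
        if "t \<in> insert 1 X" for t
      proof -
        have "(\<Prod>j<n. 1 - t * x j) = (1 - t * x j) * (\<Prod>i\<in>{..<n} - {j}. 1 - t * x i)"
          by (rule prod.remove) (use 2 in auto)
        then have "?F \<tau> t * (\<Prod>j<n. 1 - t * x j)
           = c * (squot t (x j) * (1 - t * x j)) * (\<Prod>i\<in>{..<n} - {j}. 1 - t * x i)"
          by (simp only: 2(2) mult.assoc)
        then show ?thesis using squot_mult[OF assms[OF 2(1)] that] by (simp add: poly_prod mult.assoc left_diff_distrib)
      qed
      then show ?thesis using d by blast
    qed
  qed
  have "\<forall>\<tau>\<in>{\<tau>. \<tau> permutes {..<Suc n}}. \<exists>p. degree p \<le> n \<and>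
      (\<forall>t\<in>insert 1 X. ?F \<tau> t * (\<Prod>j<n. 1 - t * x j) = poly p t)" by (intro ballI ex) (simp only: mem_Collect_eq)
  from bchoice[OF this] obtain P where
    "\<forall>\<tau>\<in>{\<tau>. \<tau> permutes {..<Suc n}}. degree (P \<tau>) \<le> n \<and>
      (\<forall>t\<in>insert 1 X. ?F \<tau> t * (\<Prod>j<n. 1 - t * x j) = poly (P \<tau>) t)" by (elim exE)
  then have P: "\<And>\<tau>. \<tau> permutes {..<Suc n} \<Longrightarrow> degree (P \<tau>) \<le> n"
    "\<And>\<tau> t. \<tau> permutes {..<Suc n} \<Longrightarrow> t \<in> insert 1 X \<Longrightarrow> ?F \<tau> t * (\<Prod>j<n. 1 - t * x j) = poly (P \<tau>) t"
    by (simp_all only: mem_Collect_eq)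
  let ?p = "\<Sum>\<tau> | \<tau> permutes {..<Suc n}. Polynomial.smult (of_int (sign \<tau>)) (P \<tau>)"
  have "degree ?p \<le> n"
    by (rule degree_sum_le)
       (use P(1) degree_smult_le order.trans in \<open>fastforce simp: finite_permutations\<close>)+
  moreover have "alt_pairs squot (Suc n) (x(n := t)) * (\<Prod>j<n. 1 - t * x j) = poly ?p t"
    if "t \<in> insert 1 X" for t
    unfolding alt_pairs_def poly_sum sum_distrib_right
    by (rule sum.cong) (use P(2)[OF _ that] in \<open>auto simp: mult.assoc\<close>)
  ultimately show ?thesis by blast
qed

text \<open>
  When the lonely slot does not hold the value \<open>1\<close>, exchanging it with the partner of \<open>1\<close>
  changes the sign of the permutation only.
\<close>

lemma alt_pairs_one_even:
  assumes "\<And>j. j < n \<Longrightarrow> x j \<in> X" "even n"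
  shows "alt_pairs squot (Suc n) (x(n := 1)) = alt_pairs squot n x"
proof -
  let ?x = "x(n := 1)"
  let ?F = "\<lambda>\<tau>. \<Prod>i<Suc n div 2. squot (?x (\<tau> (2 * i))) (?x (\<tau> (2 * i + 1)))"
  have K: "Suc n div 2 = n div 2" using assms(2) by (auto elim: evenE)
  have zero: "(\<Sum>\<tau> | \<tau> permutes {..<Suc n} \<and> \<tau> p = n. of_int (sign \<tau>) * ?F \<tau>) = 0" if p: "p < n" for p
  proof -
    \<comment> \<open>The partner of \<open>p\<close> in its pair; it is below \<open>n\<close>
      because \<open>n\<close> is even.\<close>
    define q where "q = (if even p then p + 1 else p - 1)"
    have q: "q < n" "q \<noteq> p" "q div 2 = p div 2" "even q \<longleftrightarrow> odd p"
      using p assms(2) by (auto simp: q_def elim!: evenE oddE)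
    let ?\<pi> = "transpose q n"
    show ?thesis
    proof (rule perm_sum_cancel[of _ q n "\<lambda>\<tau>. \<tau> p = n" ?F])
      fix \<tau> assume \<tau>: "\<tau> permutes {..<Suc n}" and n: "\<tau> p = n"
      have in_X: "?x (\<tau> l) \<in> X" if "l < Suc n" "l \<noteq> p" for l
      proof -
        have "\<tau> l \<noteq> n" using that n \<tau> by (metis permutes_inverses(2))
        moreover have "\<tau> l < Suc n" using permutes_in_image[OF \<tau>, of l] that by simp
        ultimately show ?thesis using assms(1) by simp
      qed
      have fixed: "?\<pi> l = l" if "l \<noteq> q" "l \<noteq> n" for l using that by (simp add: transpose_def)
      have "squot (?x ((\<tau> \<circ> ?\<pi>) (2 * i))) (?x ((\<tau> \<circ> ?\<pi>) (2 * i + 1)))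
          = squot (?x (\<tau> (2 * i))) (?x (\<tau> (2 * i + 1)))" if i: "i < Suc n div 2" for i
      proof (cases "i = p div 2")
        case False
        have "2 * i + 1 < n" using i assms(2) by (auto elim!: evenE)
        moreover have "2 * i \<noteq> q" "2 * i + 1 \<noteq> q" using False q(3) by auto
        ultimately show ?thesis by (simp add: fixed)
      next
        case True
        \<comment> \<open>One entry of this pair is 1, so its factor is 1 or -1 whatever element the
          swap brings in.\<close>
        have \<pi>p: "?\<pi> p = p" using p q by (simp add: fixed)
        have \<pi>q: "?\<pi> q = n" by (simp add: transpose_def)
        show ?thesis
        proof (cases "even p")
          case ev: True
          then have "2 * i = p" "2 * i + 1 = q" using True by (auto simp: q_def)
          then show ?thesis
            using in_X[of n] in_X[of q] p q n by (simp only: o_apply \<pi>p \<pi>q) (simp add: squot_1)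
        next
          case od: False
          then have "2 * i + 1 = p" "2 * i = q" using True by (auto simp: q_def elim!: oddE)
          then show ?thesis
            using in_X[of n] in_X[of q] p q n by (simp only: o_apply \<pi>p \<pi>q) (simp add: squot_1)
        qed
      qed
      moreover have "(\<tau> \<circ> ?\<pi>) p = n" using p q n by (simp add: fixed)
      ultimately show "(\<tau> \<circ> ?\<pi>) p = n \<and> ?F (\<tau> \<circ> ?\<pi>) = ?F \<tau>" by (auto intro!: prod.cong)
    qed (use q in auto)
  qed
  have "alt_pairs squot (Suc n) ?x = (\<Sum>\<tau> | \<tau> permutes {..<Suc n} \<and> \<tau> n = n. of_int (sign \<tau>) * ?F \<tau>)"
    unfolding alt_pairs_def sum_permutes_Suc_split sum.lessThan_Suc
    by (subst sum.neutral) (use zero in blast, rule add_0)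
  also have "\<dots> = (\<Sum>\<tau> | \<tau> permutes {..<n}. of_int (sign \<tau>) * ?F \<tau>)"
    by (simp only: permutes_lessThan_Suc_fix)
  also have "\<dots> = alt_pairs squot n x"
    unfolding alt_pairs_def K
  proof (intro sum.cong prod.cong refl arg_cong2[where f = "(*)"] arg_cong2[where f = squot])
    fix \<tau> i assume "\<tau> \<in> {\<tau>. \<tau> permutes {..<n}}" "i \<in> {..<n div 2}"
    then have "\<tau> (2 * i) < n" "\<tau> (2 * i + 1) < n"
      using permutes_in_image[of \<tau> "{..<n}"] by auto
    then show "?x (\<tau> (2 * i)) = x (\<tau> (2 * i))" "?x (\<tau> (2 * i + 1)) = x (\<tau> (2 * i + 1))" by auto
  qed
  finally show ?thesis .
qed

text \<open>All slots are paired, and the slot of 1 does not matter: a swap within a pair changes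
  the sign of the permutation and of the factor, and exchanging two whole pairs is an even
  permutation. So each of the \<open>n + 1\<close> slots gives the sum with 1 in the last slot,
  where its factor is -1.\<close>

lemma alt_pairs_one_odd:
  assumes "\<And>j. j < n \<Longrightarrow> x j \<in> X" "odd n"
  shows "alt_pairs squot (Suc n) (x(n := 1)) = - of_nat (Suc n) * alt_pairs squot n x"
proof -
  let ?x = "x(n := 1)"
  let ?F = "\<lambda>\<tau>. \<Prod>i<Suc n div 2. squot (?x (\<tau> (2 * i))) (?x (\<tau> (2 * i + 1)))"
  define k where "k = n div 2"
  have n: "n = 2 * k + 1" unfolding k_def using odd_two_times_div_two_succ[OF assms(2)] by (rule sym)
  have K: "Suc n div 2 = Suc k" by (simp add: n)
  let ?S = "\<lambda>p. \<Sum>\<tau> | \<tau> permutes {..<Suc n} \<and> \<tau> p = n. of_int (sign \<tau>) * ?F \<tau>"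
  have swap: "?S (2 * i) = ?S (2 * i + 1)" if i: "i < Suc k" for i
  proof -
    let ?\<pi> = "transpose (2 * i) (2 * i + 1)"
    have \<pi>: "?\<pi> permutes {..<Suc n}" using i by (intro permutes_swap_id) (auto simp: n)
    have F: "?F (\<tau> \<circ> ?\<pi>) = - ?F \<tau>" for \<tau>
    proof -
      have 1: "?F \<tau> = squot (?x (\<tau> (2 * i))) (?x (\<tau> (2 * i + 1))) *
          (\<Prod>j\<in>{..<Suc k} - {i}. squot (?x (\<tau> (2 * j))) (?x (\<tau> (2 * j + 1))))" for \<tau>
        unfolding K by (rule prod.remove) (use i in auto)
      have 2: "(\<Prod>j\<in>{..<Suc k} - {i}. squot (?x ((\<tau> \<circ> ?\<pi>) (2 * j))) (?x ((\<tau> \<circ> ?\<pi>) (2 * j + 1))))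
          = (\<Prod>j\<in>{..<Suc k} - {i}. squot (?x (\<tau> (2 * j))) (?x (\<tau> (2 * j + 1))))"
      proof (rule prod.cong[OF refl])
        fix j assume "j \<in> {..<Suc k} - {i}"
        then have "2 * j \<noteq> 2 * i" "2 * j + 1 \<noteq> 2 * i + 1" by simp_all
        then have "?\<pi> (2 * j) = 2 * j" "?\<pi> (2 * j + 1) = 2 * j + 1"
          using odd_neq_even by (blast intro: transpose_apply_other)+
        then show "squot (?x ((\<tau> \<circ> ?\<pi>) (2 * j))) (?x ((\<tau> \<circ> ?\<pi>) (2 * j + 1)))
            = squot (?x (\<tau> (2 * j))) (?x (\<tau> (2 * j + 1)))" by (simp only: o_apply)
      qed
      have 3: "squot (?x ((\<tau> \<circ> ?\<pi>) (2 * i))) (?x ((\<tau> \<circ> ?\<pi>) (2 * i + 1)))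
          = - squot (?x (\<tau> (2 * i))) (?x (\<tau> (2 * i + 1)))"
        by (simp only: o_apply transpose_apply_first transpose_apply_second) (rule squot_antisym)
      show ?thesis unfolding 1[of "\<tau> \<circ> ?\<pi>"] 1[of \<tau>] 2 3 by (rule mult_minus_left)
    qed
    have "?S (2 * i) = of_int (sign ?\<pi>) *
      (\<Sum>\<tau> | \<tau> permutes {..<Suc n} \<and> (\<tau> \<circ> ?\<pi>) (2 * i) = n. of_int (sign \<tau>) * ?F (\<tau> \<circ> ?\<pi>))"
      by (rule perm_sum_compose[OF _ \<pi>]) simp
    also have "\<dots> = ?S (2 * i + 1)"
      unfolding F by (simp add: sign_swap_id sum_negf)
    finally show ?thesis .
  qed
  have block: "?S (2 * i + 1) = ?S n" if i: "i < k" for i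
  proof -
    define \<pi> where "\<pi> = transpose (2 * i) (2 * k) \<circ> transpose (2 * i + 1) (2 * k + 1)"
    let ?\<rho> = "transpose i k"
    have \<pi>: "\<pi> permutes {..<Suc n}" unfolding \<pi>_def
      by (intro permutes_compose permutes_swap_id) (use i in \<open>auto simp: n\<close>)
    have sgn: "sign \<pi> = 1" unfolding \<pi>_def
      using i by (subst sign_compose) (auto simp: sign_swap_id permutation_swap_id)
    have \<pi>2: "\<pi> (2 * j) = 2 * ?\<rho> j" "\<pi> (2 * j + 1) = 2 * ?\<rho> j + 1" for j
      using odd_neq_even by (auto simp: \<pi>_def transpose_def)
    have F: "?F (\<tau> \<circ> \<pi>) = ?F \<tau>" for \<tau>
    proof -
      have \<rho>: "?\<rho> permutes {..<Suc k}" using i by (intro permutes_swap_id) auto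
      show ?thesis unfolding K
        by (subst (2) prod.permute[OF \<rho>]) (simp only: o_def \<pi>2)
    qed
    have "?S (2 * i + 1) = of_int (sign \<pi>) *
      (\<Sum>\<tau> | \<tau> permutes {..<Suc n} \<and> (\<tau> \<circ> \<pi>) (2 * i + 1) = n. of_int (sign \<tau>) * ?F (\<tau> \<circ> \<pi>))"
      by (rule perm_sum_compose[OF _ \<pi>]) simp
    also have "\<dots> = ?S n"
      unfolding F sgn by (simp only: o_apply \<pi>2) (simp add: n)
    finally show ?thesis .
  qed
  have all: "?S p = ?S n" if "p < Suc n" for p
  proof -
    have "p div 2 < Suc k" using that by (auto simp: n)
    then have "?S p = ?S (2 * (p div 2) + 1)"
      using swap[of "p div 2"] by (cases "even p") (auto elim!: evenE oddE)
    also have "\<dots> = ?S n"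
      using block[of "p div 2"] \<open>p div 2 < Suc k\<close> by (cases "p div 2 = k") (auto simp: n)
    finally show ?thesis .
  qed
  have "alt_pairs squot (Suc n) ?x = (\<Sum>p<Suc n. ?S p)"
    unfolding alt_pairs_def sum_permutes_Suc_split ..
  also have "\<dots> = (\<Sum>p<Suc n. ?S n)" by (intro sum.cong[OF refl] all) (simp only: lessThan_iff)
  also have "\<dots> = of_nat (Suc n) * ?S n" by (simp only: sum_constant card_lessThan)
  also have "?S n = (\<Sum>\<tau> | \<tau> permutes {..<n}. of_int (sign \<tau>) * ?F \<tau>)"
    by (simp only: permutes_lessThan_Suc_fix)
  also have "\<dots> = (\<Sum>\<tau> | \<tau> permutes {..<n}. - (of_int (sign \<tau>) *
      (\<Prod>i<n div 2. squot (x (\<tau> (2 * i))) (x (\<tau> (2 * i + 1))))))"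
  proof (rule sum.cong[OF refl])
    fix \<tau> assume "\<tau> \<in> {\<tau>. \<tau> permutes {..<n}}"
    then have \<tau>: "\<tau> permutes {..<n}" by simp
    have lt: "\<tau> l < n" if "l < n" for l using permutes_in_image[OF \<tau>, of l] that by simp
    have "\<tau> n = n" using permutes_not_in[OF \<tau>, of n] by simp
    have "?F \<tau> = (\<Prod>i<k. squot (?x (\<tau> (2 * i))) (?x (\<tau> (2 * i + 1)))) * squot (?x (\<tau> (2 * k))) (?x (\<tau> n))"
      unfolding K by (simp add: n)
    also have "squot (?x (\<tau> (2 * k))) (?x (\<tau> n)) = - 1"
      using lt[of "2 * k"] \<open>\<tau> n = n\<close> assms(1) by (simp add: squot_1 n)
    also have "(\<Prod>i<k. squot (?x (\<tau> (2 * i))) (?x (\<tau> (2 * i + 1))))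
        = (\<Prod>i<n div 2. squot (x (\<tau> (2 * i))) (x (\<tau> (2 * i + 1))))"
    proof (rule prod.cong)
      fix i assume "i \<in> {..<n div 2}"
      then have "\<tau> (2 * i) < n" "\<tau> (2 * i + 1) < n" by (auto intro: lt)
      then show "squot (?x (\<tau> (2 * i))) (?x (\<tau> (2 * i + 1))) = squot (x (\<tau> (2 * i))) (x (\<tau> (2 * i + 1)))" by simp
    qed (simp add: n)
    finally show "of_int (sign \<tau>) * ?F \<tau> = - (of_int (sign \<tau>) *
      (\<Prod>i<n div 2. squot (x (\<tau> (2 * i))) (x (\<tau> (2 * i + 1)))))" by simp
  qed
  finally show ?thesis by (simp only: alt_pairs_def sum_negf mult_minus_left mult_minus_right)
qed

text \<open>Induction on the number of variables. With denominators cleared, the dependence on the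
  last variable is a polynomial of degree at most \<open>n\<close> vanishing at the other
  \<open>x j\<close>; its constant \<open>C\<close> is read off at the point 1.\<close>

theorem schur_pfaffian:
  assumes "\<And>j. j < n \<Longrightarrow> x j \<in> X" "inj_on x {..<n}"
  shows "alt_pairs squot n x = 2 ^ (n div 2) * fact (n div 2) * (\<Prod>j<n. \<Prod>i<j. squot (x i) (x j))"
  using assms
proof (induction n)
  case 0
  then show ?case by (simp add: alt_pairs_def)
next
  case (Suc n)
  \<comment> \<open>The factor produced by specializing the last variable to 1.\<close>
  define e :: 'a where "e = (if even n then 1 else - of_nat (Suc n))"
  have X: "x j \<in> X" if "j < n" for j using Suc.prems(1) that by simp
  have inj: "inj_on x {..<n}" using Suc.prems(2) by (rule inj_on_subset) auto
  obtain p where p: "degree p \<le> n" "\<And>t. t \<in> insert 1 X \<Longrightarrow>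
      alt_pairs squot (Suc n) (x(n := t)) * (\<Prod>j<n. 1 - t * x j) = poly p t"
    using alt_pairs_poly[of n x] X by blast
  have "poly p (x j) = 0" if "j < n" for j
  proof -
    let ?F = "\<lambda>y. \<Prod>i<Suc n div 2. squot (y (2 * i)) (y (2 * i + 1))"
    have "alt_pairs squot (Suc n) (x(n := x j)) = 0"
      unfolding alt_pairs_def
      using perm_sum_cancel_left[of "{..<Suc n}" j n "x(n := x j)" ?F] that by (simp add: o_def)
    then show ?thesis using p(2)[of "x j"] X[OF that] by simp
  qed
  then obtain C where C: "p = Polynomial.smult C (\<Prod>j<n. [:- x j, 1:])"
    using poly_vanishing_form[OF p(1) inj] by blast
  have "alt_pairs squot (Suc n) (x(n := 1)) = e * alt_pairs squot n x"
    using alt_pairs_one_even[of n x] alt_pairs_one_odd[of n x] X by (cases "even n") (simp_all add: e_def)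
  moreover have "alt_pairs squot (Suc n) (x(n := 1)) * (\<Prod>j<n. 1 - x j) = poly p 1"
    using p(2)[of 1] by (simp only: insertI1 mult_1_left)
  moreover have "poly p 1 = C * (\<Prod>j<n. 1 - x j)" by (simp only: C poly_smult poly_prod) simp
  ultimately have "C * (\<Prod>j<n. 1 - x j) = e * alt_pairs squot n x * (\<Prod>j<n. 1 - x j)" by (simp only:)
  moreover have "(\<Prod>j<n. 1 - x j) \<noteq> 0" using iv1[OF X] by fastforce
  ultimately have Ceq: "C = e * alt_pairs squot n x" by (simp only: mult_cancel_right) simp
  have xn: "x n \<in> X" using Suc.prems(1) by simp
  \<comment> \<open>Multiplying by the inverses replaces division and turns each
    \<open>x n - x j\<close> into \<open>squot (x n) (x j)\<close>.\<close>
  have one: "(\<Prod>j<n. 1 - x n * x j) * (\<Prod>j<n. iv (1 - x n * x j)) = 1"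
    unfolding prod.distrib[symmetric] by (rule prod.neutral) (use iv xn X in auto)
  have "alt_pairs squot (Suc n) x * (\<Prod>j<n. 1 - x n * x j) = C * (\<Prod>j<n. x n - x j)"
    using p(2)[of "x n"] xn by (simp add: C poly_prod)
  then have "alt_pairs squot (Suc n) x * ((\<Prod>j<n. 1 - x n * x j) * (\<Prod>j<n. iv (1 - x n * x j)))
      = C * ((\<Prod>j<n. x n - x j) * (\<Prod>j<n. iv (1 - x n * x j)))"
    by (simp add: mult.assoc[symmetric])
  then have "alt_pairs squot (Suc n) x = C * (\<Prod>j<n. squot (x n) (x j))"
    unfolding one by (simp add: squot_def prod.distrib)
  also have "(\<Prod>j<n. squot (x n) (x j)) = (\<Prod>j<n. (- 1) * squot (x j) (x n))"
    by (intro prod.cong refl) (simp only: mult_minus1, rule squot_antisym)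
  also have "\<dots> = (- 1) ^ n * (\<Prod>j<n. squot (x j) (x n))" by (subst prod.distrib) simp
  finally have "alt_pairs squot (Suc n) x = e * (- 1) ^ n * (2 ^ (n div 2) * fact (n div 2)) *
      (\<Prod>j<Suc n. \<Prod>i<j. squot (x i) (x j))"
    using Suc.IH X inj by (simp add: Ceq mult_ac)
  \<comment> \<open>For odd \<open>n\<close> the signs cancel, and
    \<open>n + 1 = 2 * (Suc n div 2)\<close> extends the power of 2 and the factorial.\<close>
  also have "e * (- 1) ^ n * (2 ^ (n div 2) * fact (n div 2)) = 2 ^ (Suc n div 2) * fact (Suc n div 2)"
    by (cases "even n") (auto simp: e_def algebra_simps elim!: evenE oddE)
  finally show ?case .
qed

end

section \<open>Constant terms\<close>

lemma CT_simps:
  "CT_mls (0 :: 'a::comm_ring_1 mls) = 0"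
  "CT_mls (f + g) = CT_mls f + CT_mls (g :: 'a::comm_ring_1 mls)"
  "CT_mls (f - g) = CT_mls f - CT_mls (g :: 'a::comm_ring_1 mls)"
  "CT_mls (- f) = - CT_mls (f :: 'a::comm_ring_1 mls)"
  "CT_mls (1 :: 'a::comm_ring_1 mls) = 1"
  by (simp_all add: CT_mls_def coeff_mls_simps one_mls_def coeff_monom)

lemma CT_sum: "CT_mls (\<Sum>i\<in>A. f i) = (\<Sum>i\<in>A. CT_mls (f i :: 'a::comm_ring_1 mls))"
  by (induction A rule: infinite_finite_induct) (simp_all add: CT_simps)

lemma CT_of_nat_mult: "CT_mls (of_nat k * f) = of_nat k * CT_mls (f :: 'a::comm_ring_1 mls)"
  by (induction k) (simp_all add: CT_simps algebra_simps)

lemma CT_of_int_mult: "CT_mls (of_int k * f) = of_int k * CT_mls (f :: 'a::comm_ring_1 mls)"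
  by (cases k rule: int_cases2) (simp_all add: CT_simps CT_of_nat_mult)

section \<open>Supports, and constant terms of products\<close>

definition vars_in :: "nat set \<Rightarrow> 'a::comm_ring_1 mls \<Rightarrow> bool" where
  "vars_in V f \<longleftrightarrow> (\<forall>e. coeff_mls f e \<noteq> 0 \<longrightarrow> Poly_Mapping.keys e \<subseteq> V)"

definition nonneg_in :: "nat \<Rightarrow> 'a::comm_ring_1 mls \<Rightarrow> bool" where
  "nonneg_in v f \<longleftrightarrow> (\<forall>e. coeff_mls f e \<noteq> 0 \<longrightarrow> 0 \<le> Poly_Mapping.lookup e v)"

lemma coeff_mult_nonzeroD:
  assumes "coeff_mls (f * g) c \<noteq> 0"
  obtains a where "coeff_mls f a \<noteq> 0" "coeff_mls g (c - a) \<noteq> 0"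
  using assms unfolding times_mls.rep_eq by (rule conv_nonzeroD)

lemma coeff_add_nonzeroD:
  "coeff_mls (f + g) c \<noteq> 0 \<Longrightarrow> coeff_mls f c \<noteq> 0 \<or> coeff_mls g c \<noteq> 0"
  "coeff_mls (f - g) c \<noteq> 0 \<Longrightarrow> coeff_mls f c \<noteq> 0 \<or> coeff_mls g c \<noteq> 0"
  by (auto simp: coeff_mls_simps)

lemma vars_in_mult: "vars_in V f \<Longrightarrow> vars_in V g \<Longrightarrow> vars_in V (f * g)"
proof -
  assume fg: "vars_in V f" "vars_in V g"
  have "Poly_Mapping.keys c \<subseteq> V" if "coeff_mls (f * g) c \<noteq> 0" for c
  proof -
    obtain a where "coeff_mls f a \<noteq> 0" "coeff_mls g (c - a) \<noteq> 0"
      using \<open>coeff_mls (f * g) c \<noteq> 0\<close> by (rule coeff_mult_nonzeroD)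
    then have "Poly_Mapping.keys a \<subseteq> V" "Poly_Mapping.keys (c - a) \<subseteq> V"
      using fg by (auto simp: vars_in_def)
    then show ?thesis using keys_add[of a "c - a"] by auto
  qed
  then show ?thesis by (simp add: vars_in_def)
qed

lemma nonneg_in_mult: "nonneg_in v f \<Longrightarrow> nonneg_in v g \<Longrightarrow> nonneg_in v (f * g)"
proof -
  assume fg: "nonneg_in v f" "nonneg_in v g"
  have "0 \<le> Poly_Mapping.lookup c v" if "coeff_mls (f * g) c \<noteq> 0" for c
  proof -
    obtain a where "coeff_mls f a \<noteq> 0" "coeff_mls g (c - a) \<noteq> 0"
      using \<open>coeff_mls (f * g) c \<noteq> 0\<close> by (rule coeff_mult_nonzeroD)
    then have "0 \<le> Poly_Mapping.lookup a v" "0 \<le> Poly_Mapping.lookup (c - a) v"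
      using fg by (auto simp: nonneg_in_def)
    then show ?thesis by (simp add: lookup_minus)
  qed
  then show ?thesis by (simp add: nonneg_in_def)
qed

lemma vars_in_add:
  "vars_in V f \<Longrightarrow> vars_in V g \<Longrightarrow> vars_in V (f + g)"
  "vars_in V f \<Longrightarrow> vars_in V g \<Longrightarrow> vars_in V (f - g)"
  unfolding vars_in_def by (meson coeff_add_nonzeroD)+

lemma nonneg_in_diff: "nonneg_in v f \<Longrightarrow> nonneg_in v g \<Longrightarrow> nonneg_in v (f - g)"
  unfolding nonneg_in_def by (meson coeff_add_nonzeroD)

lemma vars_in_mono: "vars_in V f \<Longrightarrow> V \<subseteq> W \<Longrightarrow> vars_in W f"
  unfolding vars_in_def by blast

lemma vars_in_basic:
  "vars_in V 1"
  "v \<in> V \<Longrightarrow> vars_in V (var_mls v)"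
  "v \<in> V \<Longrightarrow> vars_in V (inverse (var_mls v))"
  unfolding inverse_var_mls by (auto simp: vars_in_def one_mls_def var_mls_def coeff_monom)

lemma vars_in_power: "vars_in V f \<Longrightarrow> vars_in V (f ^ k)"
  by (induction k) (simp_all add: vars_in_basic vars_in_mult)

lemma vars_in_prod: "(\<And>i. i \<in> I \<Longrightarrow> vars_in V (f i)) \<Longrightarrow> vars_in V (\<Prod>i\<in>I. f i)"
  by (induction I rule: infinite_finite_induct) (simp_all add: vars_in_basic vars_in_mult)

lemma nonneg_in_basic:
  "nonneg_in v 1"
  "nonneg_in v (var_mls w)"
  "v \<noteq> w \<Longrightarrow> nonneg_in v (inverse (var_mls w))"
  unfolding inverse_var_mls
  by (auto simp: nonneg_in_def one_mls_def var_mls_def coeff_monom lookup_single when_def)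

lemma nonneg_in_power: "nonneg_in v f \<Longrightarrow> nonneg_in v (f ^ k)"
  by (induction k) (simp_all add: nonneg_in_basic nonneg_in_mult)

lemma nonneg_in_inverse:
  "nonneg_in v (inverse (1 - var_mls i))"
  "nonneg_in v (inverse (1 - var_mls i * var_mls j))"
  unfolding inverse_one_minus_var inverse_one_minus_var_mult_var
  by (auto simp: nonneg_in_def coeff_geom)

lemma vars_in_inverse:
  "i \<in> V \<Longrightarrow> vars_in V (inverse (1 - var_mls i))"
  "i \<in> V \<Longrightarrow> j \<in> V \<Longrightarrow> vars_in V (inverse (1 - var_mls i * var_mls j))"
  unfolding inverse_one_minus_var inverse_one_minus_var_mult_var
  by (auto simp: vars_in_def coeff_geom in_keys_iff lookup_add lookup_single when_def split: if_splits)

text \<open>A contribution to the constant term needs exponents \<open>a\<close> and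
  \<open>- a\<close> in the two factors. Both involve the same variables, which lie in
  \<open>V\<close> and in \<open>W\<close>, so \<open>a = 0\<close>.\<close>

lemma CT_mult_disjoint:
  assumes "vars_in V f" "vars_in W g" "V \<inter> W = {}"
  shows "CT_mls (f * g) = CT_mls f * CT_mls g"
proof -
  have "a = 0" if "coeff_mls f a \<noteq> 0" "coeff_mls g (0 - a) \<noteq> 0" for a
  proof -
    have "Poly_Mapping.keys a \<subseteq> V" "Poly_Mapping.keys (0 - a) \<subseteq> W"
      using assms(1,2) that unfolding vars_in_def by blast+
    moreover have "Poly_Mapping.keys (0 - a) = Poly_Mapping.keys a"
      by (auto simp: in_keys_iff lookup_minus)
    ultimately have "Poly_Mapping.keys a = {}" using assms(3) by blast
    then show ?thesis by simp
  qed
  then show ?thesis unfolding CT_mls_def times_mls.rep_eq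
    by (subst conv_eq_sum[where A = "{0}"]) auto
qed

lemma CT_prod_disjoint:
  assumes "finite I" "\<And>i. i \<in> I \<Longrightarrow> vars_in (V i) (f i)"
    "\<And>i j. i \<in> I \<Longrightarrow> j \<in> I \<Longrightarrow> i \<noteq> j \<Longrightarrow> V i \<inter> V j = {}"
  shows "CT_mls (\<Prod>i\<in>I. f i) = (\<Prod>i\<in>I. CT_mls (f i))"
  using assms
proof (induction I rule: finite_induct)
  case empty
  then show ?case by (simp add: CT_simps)
next
  case (insert i I)
  have "vars_in (\<Union>j\<in>I. V j) (\<Prod>j\<in>I. f j)"
    by (rule vars_in_prod, rule vars_in_mono[of "V _"]) (use insert.prems in auto)
  moreover have "V i \<inter> (\<Union>j\<in>I. V j) = {}" using insert.prems(2)[of i] insert.hyps by auto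
  ultimately have "CT_mls (f i * (\<Prod>j\<in>I. f j)) = CT_mls (f i) * CT_mls (\<Prod>j\<in>I. f j)"
    using insert.prems(1)[of i] by (intro CT_mult_disjoint) auto
  then show ?case using insert by simp
qed

lemma CT_var_mult: "nonneg_in v f \<Longrightarrow> CT_mls (var_mls v * f) = 0"
proof (rule ccontr)
  assume f: "nonneg_in v f" and "CT_mls (var_mls v * f) \<noteq> 0"
  then have "coeff_mls f (0 - Poly_Mapping.single v 1) \<noteq> 0"
    by (simp add: CT_mls_def var_mls_def coeff_monom_times)
  with f have "0 \<le> Poly_Mapping.lookup (0 - Poly_Mapping.single v (1::int)) v"
    unfolding nonneg_in_def by blast
  then show False by (simp add: lookup_minus)
qed

section \<open>Geometric series and the kernel of a pair of variables\<close>

lemma unit_mult_inverse: "(f :: 'a::comm_ring_1 mls) dvd 1 \<Longrightarrow> f * inverse f = 1"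
  by (metis dvdE inverse_mls_unique)

lemma one_minus_var_inverse:
  "(1 - var_mls i) * inverse (1 - var_mls i) = (1 :: 'a::comm_ring_1 mls)"
  "(1 - var_mls i * var_mls j) * inverse (1 - var_mls i * var_mls j) = (1 :: 'a mls)"
  by (intro unit_mult_inverse one_minus_var_units)+

lemma var_mult_inverse: "var_mls i * inverse (var_mls i) = (1 :: 'a::comm_ring_1 mls)"
  unfolding inverse_var_mls by (simp add: var_mls_def monom_mult_monom one_mls_def flip: single_add)

lemma CT_inverse_var_power: "CT_mls (inverse (var_mls v) ^ p :: 'a::comm_ring_1 mls) = (if p = 0 then 1 else 0)"
proof -
  have "inverse (var_mls v) ^ p = (monom_mls (Poly_Mapping.single v (- int p)) 1 :: 'a mls)"
    by (induction p) (simp_all add: one_mls_def inverse_var_mls monom_mult_monom flip: single_add)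
  moreover have "Poly_Mapping.single v (- int p) = 0 \<longleftrightarrow> p = 0"
    by (metis lookup_single_eq lookup_zero neg_equal_0_iff_equal of_nat_eq_0_iff single_zero of_nat_0 neg_0_equal_iff_equal)
  ultimately show ?thesis by (auto simp: CT_mls_def coeff_monom)
qed

text \<open>Iterating \<open>h = 1 + x * h\<close> for the geometric series \<open>h\<close> lowers
  \<open>p\<close> down to 0; the terms split off on the way are pure negative powers.\<close>

lemma CT_geometric: "CT_mls (inverse (var_mls v) ^ p * inverse (1 - var_mls v) :: 'a::comm_ring_1 mls) = 1"
proof (induction p)
  let ?x = "var_mls v :: 'a mls" and ?h = "inverse (1 - var_mls v) :: 'a mls"
  have h: "?h = 1 + ?x * ?h" using one_minus_var_inverse(1)[of v, where 'a = 'a] by (simp add: algebra_simps)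
  {
    case 0
    have "CT_mls ?h = CT_mls (1 + ?x * ?h)" using h by simp
    also have "\<dots> = 1" by (simp add: CT_simps CT_var_mult nonneg_in_inverse)
    finally show ?case by simp
  next
    case (Suc p)
    have "inverse ?x ^ Suc p * (1 + ?x * ?h) = inverse ?x ^ Suc p + (?x * inverse ?x) * (inverse ?x ^ p * ?h)"
      by (simp add: algebra_simps)
    also have "\<dots> = inverse ?x ^ Suc p + inverse ?x ^ p * ?h" by (simp add: var_mult_inverse)
    finally have "CT_mls (inverse ?x ^ Suc p * ?h) = CT_mls (inverse ?x ^ Suc p + inverse ?x ^ p * ?h)"
      using h by metis
    then show ?case using Suc by (simp only: CT_simps CT_inverse_var_power) simp
  }
qed

text \<open>The factor \<open>squot\<close> of a pair together with its two geometric series. By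
  \<open>CT_kappa\<close> its coefficient at \<open>x^a y^b\<close> is
  \<open>sgn (a - b)\<close>.\<close>

definition kappa :: "nat \<Rightarrow> nat \<Rightarrow> 'a::comm_ring_1 mls" where
  "kappa v w = (var_mls v - var_mls w) * inverse (1 - var_mls v * var_mls w) *
     (inverse (1 - var_mls v) * inverse (1 - var_mls w))"

lemma kappa_antisym: "kappa w v = - kappa v w"
  by (simp add: kappa_def algebra_simps mult.commute[of "var_mls w" "var_mls v"])

text \<open>Since \<open>sgn (a - b)\<close> is unchanged when both exponents drop by 1,
  \<open>kappa\<close> reproduces itself up to terms in one variable, found by partial
  fractions.\<close>

lemma kappa_rec:
  "kappa v w = var_mls v * (var_mls w * kappa v w) +
     (var_mls v * inverse (1 - var_mls v) - var_mls w * inverse (1 - var_mls w)) " (is "?k = _")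
proof -
  let ?x = "var_mls v" and ?y = "var_mls w"
  let ?hx = "inverse (1 - ?x)" and ?hy = "inverse (1 - ?y)"
  have "(1 - ?x * ?y) * ?k = ((1 - ?x * ?y) * inverse (1 - ?x * ?y)) * (?x - ?y) * (?hx * ?hy)"
    unfolding kappa_def by (simp only: mult_ac)
  also have "\<dots> = (?x - ?y) * (?hx * ?hy)" by (simp only: one_minus_var_inverse mult_1_left)
  also have "\<dots> = ?x * ?hx * ((1 - ?y) * ?hy) - ?y * ?hy * ((1 - ?x) * ?hx)"
    by (simp add: algebra_simps)
  finally have "(1 - ?x * ?y) * ?k = ?x * ?hx - ?y * ?hy"
    by (simp only: one_minus_var_inverse mult_1_right)
  then show ?thesis by (simp add: algebra_simps)
qed

lemma nonneg_in_kappa: "nonneg_in u (kappa v w)"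
  unfolding kappa_def by (intro nonneg_in_mult nonneg_in_diff nonneg_in_basic nonneg_in_inverse)

lemma vars_in_kappa: "v \<in> V \<Longrightarrow> w \<in> V \<Longrightarrow> vars_in V (kappa v w)"
  unfolding kappa_def by (intro vars_in_mult vars_in_add vars_in_basic vars_in_inverse)

text \<open>Terms with a factor \<open>var_mls w\<close> and no negative powers of it have no
  constant term; what remains is the series \<open>x / (1 - x)\<close> in the other
  variable.\<close>

lemma CT_kappa_zero:
  assumes "v \<noteq> w"
  shows "CT_mls (inverse (var_mls v) ^ p * kappa v w) = (if p = 0 then 0 else (1 :: 'a::comm_ring_1))"
proof -
  let ?x = "var_mls v :: 'a mls" and ?y = "var_mls w :: 'a mls"
  let ?u = "inverse ?x ^ p"
  have "?u * kappa v w = ?u * (?x * (?y * kappa v w) + (?x * inverse (1 - ?x) - ?y * inverse (1 - ?y)))"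
    by (rule arg_cong[OF kappa_rec])
  also have "\<dots> = ?y * (?u * ?x * kappa v w) + ?u * (?x * inverse (1 - ?x)) - ?y * (?u * inverse (1 - ?y))"
    by (simp add: algebra_simps)
  also have "CT_mls \<dots> = CT_mls (?u * (?x * inverse (1 - ?x)))"
  proof -
    have "nonneg_in w (?u * ?x * kappa v w)" "nonneg_in w (?u * inverse (1 - ?y))"
      using assms by (intro nonneg_in_mult nonneg_in_power nonneg_in_basic nonneg_in_inverse nonneg_in_kappa; simp)+
    then show ?thesis by (simp add: CT_simps CT_var_mult)
  qed
  also have "\<dots> = (if p = 0 then 0 else 1)"
  proof (cases p)
    case 0
    then show ?thesis by (simp add: CT_var_mult nonneg_in_inverse)
  next
    case (Suc q)
    have "?u * (?x * inverse (1 - ?x)) = (?x * inverse ?x) * (inverse ?x ^ q * inverse (1 - ?x))"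
      by (simp add: Suc algebra_simps)
    then show ?thesis by (simp add: var_mult_inverse CT_geometric Suc)
  qed
  finally show ?thesis .
qed

text \<open>Induction along the diagonal: \<open>kappa_rec\<close> lowers both exponents, and its
  one-variable terms vanish against a negative power of the other variable. If an exponent is 0,
  \<open>CT_kappa_zero\<close> applies, after antisymmetry where necessary.\<close>

lemma CT_kappa:
  assumes "v \<noteq> w"
  shows "CT_mls (inverse (var_mls v) ^ p * inverse (var_mls w) ^ q * kappa v w)
    = (of_int (sgn (int p - int q)) :: 'a::comm_ring_1)"
proof (induction p arbitrary: q)
  case 0
  have "CT_mls (inverse (var_mls w) ^ q * kappa v w) = - CT_mls (inverse (var_mls w) ^ q * kappa w v :: 'a mls)"
    by (simp add: kappa_antisym[of w v] CT_simps)
  then show ?case using CT_kappa_zero[of w v q, where 'a = 'a] assms by (auto simp: sgn_if)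
next
  case (Suc p)
  let ?x = "var_mls v :: 'a mls" and ?y = "var_mls w :: 'a mls"
  show ?case
  proof (cases q)
    case 0
    then show ?thesis using CT_kappa_zero[OF assms, of "Suc p", where 'a = 'a] by simp
  next
    case (Suc r)
    let ?u = "inverse ?x ^ Suc p" and ?v = "inverse ?y ^ Suc r"
    have "?u * ?v * kappa v w = ?u * ?v * (?x * (?y * kappa v w) + (?x * inverse (1 - ?x) - ?y * inverse (1 - ?y)))"
      by (rule arg_cong[OF kappa_rec])
    also have "\<dots> = (?x * inverse ?x) * (?y * inverse ?y) * (inverse ?x ^ p * inverse ?y ^ r * kappa v w)
        + (?u * (?x * inverse (1 - ?x))) * ?v - ?u * (?v * (?y * inverse (1 - ?y)))"
      by (simp add: algebra_simps)
    also have "CT_mls \<dots> = CT_mls (inverse ?x ^ p * inverse ?y ^ r * kappa v w)"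
    proof -
      have "CT_mls ((?u * (?x * inverse (1 - ?x))) * ?v) = CT_mls (?u * (?x * inverse (1 - ?x))) * CT_mls ?v"
        using assms by (intro CT_mult_disjoint[of "{v}" _ "{w}"] vars_in_mult vars_in_power vars_in_basic vars_in_inverse) auto
      moreover have "CT_mls (?u * (?v * (?y * inverse (1 - ?y)))) = CT_mls ?u * CT_mls (?v * (?y * inverse (1 - ?y)))"
        using assms by (intro CT_mult_disjoint[of "{v}" _ "{w}"] vars_in_mult vars_in_power vars_in_basic vars_in_inverse) auto
      ultimately show ?thesis by (simp only: CT_simps CT_inverse_var_power var_mult_inverse) simp
    qed
    finally show ?thesis using Suc.IH[of r] Suc by simp
  qed
qed

section \<open>The constant term as a sum over permutations\<close>

lemma prod_pairs:
  "(\<Prod>(i, j)\<in>{(i, j). 1 \<le> i \<and> i < j \<and> j \<le> n}. f i j) = (\<Prod>j<n. \<Prod>i<j. f (Suc i) (Suc j))"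
proof -
  have "(\<Prod>j<n. \<Prod>i<j. f (Suc i) (Suc j)) = (\<Prod>(j, i)\<in>(SIGMA j:{..<n}. {..<j}). f (Suc i) (Suc j))"
    by (subst prod.Sigma) auto
  also have "\<dots> = (\<Prod>(i, j)\<in>{(i, j). 1 \<le> i \<and> i < j \<and> j \<le> n}. f i j)"
    by (rule prod.reindex_bij_witness[of _ "\<lambda>(i, j). (j - 1, i - 1)" "\<lambda>(j, i). (Suc i, Suc j)"]) auto
  finally show ?thesis ..
qed

lemma prod_1_n: "(\<Prod>i\<in>{1..n}. f i) = (\<Prod>i<n. f (Suc i))"
  by (simp add: prod.atLeast1_atMost_eq)

text \<open>The inverse is multiplicative on units, so the induction carries the divisibility claim
  along.\<close>

lemma inverse_mls_prod:
  fixes f :: "'b \<Rightarrow> 'a::comm_ring_1 mls"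
  assumes "\<And>i. i \<in> I \<Longrightarrow> f i dvd 1"
  shows "inverse (\<Prod>i\<in>I. f i) = (\<Prod>i\<in>I. inverse (f i)) \<and> (\<Prod>i\<in>I. f i) dvd 1"
  using assms
proof (induction I rule: infinite_finite_induct)
  case (insert i I)
  then show ?case by (simp add: inverse_mls_mult)
qed (simp_all add: inverse_mls_unique)

interpretation mls_schur: schur "range (var_mls :: nat \<Rightarrow> rat mls)" inverse
  by unfold_locales (auto simp: one_minus_var_inverse)

lemma inj_var_mls: "inj (var_mls :: nat \<Rightarrow> 'a::comm_ring_1 mls)"
proof (rule injI)
  fix i j :: nat
  assume "var_mls i = (var_mls j :: 'a mls)"
  then have "coeff_mls (var_mls j :: 'a mls) (Poly_Mapping.single i 1) = 1"
    by (metis coeff_monom var_mls_def)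
  then have "Poly_Mapping.single i (1::int) = Poly_Mapping.single j 1"
    by (auto simp: var_mls_def coeff_monom split: if_splits)
  then show "i = j" by (metis lookup_single_eq lookup_single_not_eq zero_neq_one)
qed

lemma prod_lessThan_pairs:
  fixes h :: "nat \<Rightarrow> 'a::comm_monoid_mult"
  shows "(\<Prod>i<n. h i) = (\<Prod>i<n div 2. h (2 * i) * h (2 * i + 1)) * (if odd n then h (n - 1) else 1)"
proof -
  have "(\<Prod>i<2 * k. h i) = (\<Prod>i<k. h (2 * i) * h (2 * i + 1))" for k
    by (induction k) (simp_all add: mult.assoc)
  then show ?thesis by (cases "even n") (auto elim!: evenE oddE)
qed

text \<open>The two signs multiply to that of \<open>\<sigma> \<circ> \<tau>\<close>, and every
  product \<open>\<rho>\<close> is counted once for each \<open>\<tau>\<close>. The resulting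
  factorial cancels the prefactor of \<open>L_const\<close>.\<close>

lemma double_perm_sum:
  fixes H :: "('b \<Rightarrow> 'b) \<Rightarrow> 'a::{comm_ring_1,ring_char_0}"
  assumes "finite S"
  shows "(\<Sum>\<tau> | \<tau> permutes S. \<Sum>\<sigma> | \<sigma> permutes S. of_int (sign \<sigma>) * of_int (sign \<tau>) * H (\<sigma> \<circ> \<tau>))
     = fact (card S) * (\<Sum>\<rho> | \<rho> permutes S. of_int (sign \<rho>) * H \<rho>)"
proof -
  have "(\<Sum>\<sigma> | \<sigma> permutes S. of_int (sign \<sigma>) * of_int (sign \<tau>) * H (\<sigma> \<circ> \<tau>))
      = (\<Sum>\<rho> | \<rho> permutes S. of_int (sign \<rho>) * H \<rho>)" if "\<tau> permutes S" for \<tau>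
    using perm_sum_compose[OF assms that, where P = "\<lambda>_. True" and F = H]
    by (simp add: sum_distrib_left mult_ac)
  then have "(\<Sum>\<tau> | \<tau> permutes S. \<Sum>\<sigma> | \<sigma> permutes S. of_int (sign \<sigma>) * of_int (sign \<tau>) * H (\<sigma> \<circ> \<tau>))
      = (\<Sum>\<tau> | \<tau> permutes S. \<Sum>\<rho> | \<rho> permutes S. of_int (sign \<rho>) * H \<rho>)"
    by (rule sum.cong[OF refl]) simp
  also have "\<dots> = of_nat (card {\<tau>. \<tau> permutes S}) * (\<Sum>\<rho> | \<rho> permutes S. of_int (sign \<rho>) * H \<rho>)"
    by simp
  finally show ?thesis using card_permutations[OF refl assms] by simp
qed

text \<open>The value \<open>M(z^m g(u)^a g(1/u)^b)\<close>, written out by the binomial theorem. It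
  is reached from two sides: as a constant term in two variables (\<open>CT_pair\<close>) and as a
  sign sum in one (\<open>has_sgn_sum_pair_fls\<close>).\<close>

definition pair_ct :: "nat \<Rightarrow> nat \<Rightarrow> nat \<Rightarrow> rat" where
  "pair_ct m a b = (\<Sum>i\<le>m + a. \<Sum>j\<le>m + b. of_nat ((m + a) choose i) * of_nat ((m + b) choose j) *
     of_int (sgn (int (i + a) - int (j + b))))"

definition L_term :: "nat \<Rightarrow> nat \<Rightarrow> (nat \<Rightarrow> nat) \<Rightarrow> rat" where
  "L_term n m \<rho> = (\<Prod>i<n div 2. pair_ct m (\<rho> (2 * i)) (\<rho> (2 * i + 1))) *
     (if odd n then 2 ^ (m + \<rho> (n - 1)) else 1)"

lemma binomial_g_fun:
  fixes u :: "'a::comm_ring_1"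
  shows "(1 + u) ^ m * g_fun u ^ a = (\<Sum>i\<le>m + a. of_nat ((m + a) choose i) * u ^ (i + a))"
proof -
  have "(1 + u) ^ m * g_fun u ^ a = (u + 1) ^ (m + a) * u ^ a"
    by (simp add: g_fun_def power_mult_distrib power_add mult_ac add.commute)
  also have "\<dots> = (\<Sum>i\<le>m + a. of_nat ((m + a) choose i) * u ^ (i + a))"
    unfolding binomial_ring[of u 1 "m + a"] sum_distrib_right
    by (intro sum.cong refl) (simp add: power_add mult_ac)
  finally show ?thesis .
qed

lemma CT_pair:
  assumes "v \<noteq> w"
  shows "CT_mls (((1 + inverse (var_mls v)) ^ m * g_fun (inverse (var_mls v)) ^ a) *
    ((1 + inverse (var_mls w)) ^ m * g_fun (inverse (var_mls w)) ^ b) * kappa v w) = pair_ct m a b"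
proof -
  let ?u = "inverse (var_mls v) :: rat mls" and ?v = "inverse (var_mls w) :: rat mls"
  have "((1 + ?u) ^ m * g_fun ?u ^ a) * ((1 + ?v) ^ m * g_fun ?v ^ b) * kappa v w =
    (\<Sum>i\<le>m + a. \<Sum>j\<le>m + b. of_nat ((m + a) choose i) * (of_nat ((m + b) choose j) *
       (?u ^ (i + a) * ?v ^ (j + b) * kappa v w)))"
    unfolding binomial_g_fun sum_product unfolding sum_distrib_right by (intro sum.cong refl) (simp only: mult_ac)
  then show ?thesis
    by (simp only: CT_sum CT_of_nat_mult CT_kappa[OF assms, unfolded mult.assoc] pair_ct_def mult.assoc)
qed

lemma CT_single:
  "CT_mls (((1 + inverse (var_mls v)) ^ m * g_fun (inverse (var_mls v)) ^ a) * inverse (1 - var_mls v))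
    = (2 ^ (m + a) :: rat)"
proof -
  have "(\<Sum>i\<le>m + a. of_nat ((m + a) choose i)) = (2 ^ (m + a) :: rat)"
    using choose_row_sum[of "m + a"] by (metis of_nat_numeral of_nat_power of_nat_sum)
  then show ?thesis
    unfolding binomial_g_fun sum_distrib_right
    by (simp only: CT_sum CT_of_nat_mult CT_geometric mult.assoc mult_1_right)
qed

text \<open>The Vandermonde product is expanded over exponents \<open>\<sigma>\<close>, the Pfaffian
  over pairings \<open>\<tau>\<close>. The constant term of a summand depends on
  \<open>\<sigma> \<circ> \<tau>\<close> alone, so the double sum collapses.\<close>

lemma L_const_perm_sum:
  "2 ^ (n div 2) * fact (n div 2) * L_const n m = (\<Prod>j<n. (- 1) ^ j) *
     (\<Sum>\<rho> | \<rho> permutes {..<n}. of_int (sign \<rho>) * L_term n m \<rho>)"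
proof -
  define X where "X i = (var_mls (Suc i) :: rat mls)" for i
  define U where "U i = inverse (X i)" for i
  define Q where "Q c i = (1 + U i) ^ m * g_fun (U i) ^ c" for c i
  define G where "G \<sigma> \<tau> = (\<Prod>i<n. Q (\<sigma> i) i) *
      ((\<Prod>i<n div 2. mls_schur.squot (X (\<tau> (2 * i))) (X (\<tau> (2 * i + 1)))) * (\<Prod>i<n. inverse (1 - X i)))"
    for \<sigma> \<tau>
  define c :: nat where "c = 2 ^ (n div 2) * fact (n div 2)"
  define s :: int where "s = (\<Prod>j<n. (- 1) ^ j)"
  let ?S = "{\<sigma>. \<sigma> permutes {..<n}}"
  define W where "W = ((\<Prod>r\<in>{1..n}. (1 + inverse (var_mls r)) ^ m) *
          (\<Prod>(i, j)\<in>{(i, j). 1 \<le> i \<and> i < j \<and> j \<le> n}.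
             (var_mls i - var_mls j) * (g_fun (inverse (var_mls i)) - g_fun (inverse (var_mls j)))))
         / ((\<Prod>i\<in>{1..n}. 1 - var_mls i) *
            (\<Prod>(i, j)\<in>{(i, j). 1 \<le> i \<and> i < j \<and> j \<le> n}. 1 - var_mls i * (var_mls j :: rat mls)))"
  have s2: "s * s = 1" unfolding s_def prod.distrib[symmetric] by (simp flip: power_mult_distrib)
  have "diff_prod n (\<lambda>i. g_fun (U i)) = of_int (s * s) * diff_prod n (\<lambda>i. g_fun (U i))" by (simp add: s2)
  then have dp: "diff_prod n (\<lambda>i. g_fun (U i)) = of_int s * alt_powers n (\<lambda>i. g_fun (U i))"
    unfolding alt_powers_eq by (simp add: s_def mult.assoc)
  have cX: "of_nat c * (\<Prod>j<n. \<Prod>i<j. mls_schur.squot (X i) (X j)) = alt_pairs mls_schur.squot n X"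
    by (subst mls_schur.schur_pfaffian)
       (auto simp: c_def X_def inj_on_def dest: injD[OF inj_var_mls])
  have inv: "inverse ((\<Prod>i<n. 1 - X i) * (\<Prod>j<n. \<Prod>i<j. 1 - X i * X j))
      = (\<Prod>i<n. inverse (1 - X i)) * (\<Prod>j<n. \<Prod>i<j. inverse (1 - X i * X j))"
  proof -
    have 1: "inverse (\<Prod>i<n. 1 - X i) = (\<Prod>i<n. inverse (1 - X i)) \<and> (\<Prod>i<n. 1 - X i) dvd 1"
      by (rule inverse_mls_prod) (simp add: X_def one_minus_var_units)
    have 2: "inverse (\<Prod>i<j. 1 - X i * X j) = (\<Prod>i<j. inverse (1 - X i * X j)) \<and> (\<Prod>i<j. 1 - X i * X j) dvd 1" for j
      by (rule inverse_mls_prod) (simp add: X_def one_minus_var_units)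
    have 3: "inverse (\<Prod>j<n. \<Prod>i<j. 1 - X i * X j) = (\<Prod>j<n. inverse (\<Prod>i<j. 1 - X i * X j)) \<and>
        (\<Prod>j<n. \<Prod>i<j. 1 - X i * X j) dvd 1"
      by (rule inverse_mls_prod) (simp add: 2)
    show ?thesis using 1 2 3 by (simp add: inverse_mls_mult)
  qed
  have "W = ((\<Prod>i<n. (1 + U i) ^ m) * (\<Prod>j<n. \<Prod>i<j. (X i - X j) * (g_fun (U i) - g_fun (U j)))) *
      inverse ((\<Prod>i<n. 1 - X i) * (\<Prod>j<n. \<Prod>i<j. 1 - X i * X j))"
    unfolding W_def divide_mls_def prod_pairs prod_1_n X_def U_def ..
  also have "\<dots> = (\<Prod>i<n. (1 + U i) ^ m) * diff_prod n (\<lambda>i. g_fun (U i)) *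
      ((\<Prod>j<n. \<Prod>i<j. mls_schur.squot (X i) (X j)) * (\<Prod>i<n. inverse (1 - X i)))"
    unfolding inv diff_prod_def mls_schur.squot_def prod.distrib by (simp only: mult_ac)
  finally have "of_nat c * W = of_int s * ((\<Prod>i<n. (1 + U i) ^ m) * alt_powers n (\<lambda>i. g_fun (U i)) *
      (alt_pairs mls_schur.squot n X * (\<Prod>i<n. inverse (1 - X i))))"
    unfolding cX[symmetric] dp by (simp only: mult_ac)
  also have "(\<Prod>i<n. (1 + U i) ^ m) * alt_powers n (\<lambda>i. g_fun (U i)) =
      (\<Sum>\<sigma>\<in>?S. of_int (sign \<sigma>) * (\<Prod>i<n. Q (\<sigma> i) i))"
    unfolding alt_powers_def sum_distrib_left Q_def prod.distrib by (simp only: mult_ac)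
  also have "\<dots> * (alt_pairs mls_schur.squot n X * (\<Prod>i<n. inverse (1 - X i))) =
      (\<Sum>\<sigma>\<in>?S. \<Sum>\<tau>\<in>?S. of_int (sign \<sigma> * sign \<tau>) * G \<sigma> \<tau>)"
    unfolding alt_pairs_def sum_distrib_right unfolding sum_distrib_left G_def of_int_mult
    by (intro sum.cong refl) (simp only: mult_ac)
  finally have cW: "of_nat c * CT_mls W =
      of_int s * (\<Sum>\<sigma>\<in>?S. \<Sum>\<tau>\<in>?S. of_int (sign \<sigma> * sign \<tau>) * CT_mls (G \<sigma> \<tau>))"
    by (simp only: CT_of_nat_mult[symmetric] CT_of_int_mult CT_sum)
  have CT_G: "CT_mls (G \<sigma> \<tau>) = L_term n m (\<sigma> \<circ> \<tau>)" if \<sigma>: "\<sigma> permutes {..<n}" and \<tau>: "\<tau> permutes {..<n}" for \<sigma> \<tau>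
  proof -
    \<comment> \<open>\<open>P i\<close> collects everything in the two variables of pair
      \<open>i\<close>, and \<open>R\<close> everything in the unpaired variable; different factors
      share no variable.\<close>
    define P where "P i = Q (\<sigma> (\<tau> (2 * i))) (\<tau> (2 * i)) * Q (\<sigma> (\<tau> (2 * i + 1))) (\<tau> (2 * i + 1)) *
      kappa (Suc (\<tau> (2 * i))) (Suc (\<tau> (2 * i + 1)))" for i
    define R where "R = (if odd n then Q (\<sigma> (\<tau> (n - 1))) (\<tau> (n - 1)) * inverse (1 - X (\<tau> (n - 1))) else 1)"
    define V where "V i = {Suc (\<tau> (2 * i)), Suc (\<tau> (2 * i + 1))}" for i
    define V' where "V' = (if odd n then {Suc (\<tau> (n - 1))} else {})"
    have inj: "\<tau> i = \<tau> j \<longleftrightarrow> i = j" for i j using \<tau> by (metis permutes_inverses(2))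
    have vars_g: "vars_in V (g_fun f)" if "vars_in V f" for V and f :: "rat mls"
      unfolding g_fun_def using that by (intro vars_in_mult vars_in_add vars_in_basic)
    have vars_Q: "vars_in V (Q c i)" if "Suc i \<in> V" for V c i
      unfolding Q_def U_def X_def using that
      by (intro vars_in_mult vars_in_power vars_in_add vars_g vars_in_basic)
    have vars_P: "vars_in (V i) (P i)" for i
      unfolding P_def V_def by (intro vars_in_mult vars_Q vars_in_kappa) auto
    have vars_R: "vars_in V' R"
      unfolding R_def V'_def X_def by (auto intro!: vars_in_mult vars_Q vars_in_inverse vars_in_basic)
    have "G \<sigma> \<tau> = (\<Prod>i<n. Q (\<sigma> i) i * inverse (1 - X i)) *
        (\<Prod>i<n div 2. mls_schur.squot (X (\<tau> (2 * i))) (X (\<tau> (2 * i + 1))))"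
      unfolding G_def prod.distrib by (simp only: mult_ac)
    \<comment> \<open>Reordering by \<open>\<tau>\<close> puts paired variables next to each
      other.\<close>
    also have "(\<Prod>i<n. Q (\<sigma> i) i * inverse (1 - X i)) = (\<Prod>i<n. Q (\<sigma> (\<tau> i)) (\<tau> i) * inverse (1 - X (\<tau> i)))"
      by (subst prod.permute[OF \<tau>]) (simp only: o_def)
    also have "\<dots> = (\<Prod>i<n div 2. (Q (\<sigma> (\<tau> (2 * i))) (\<tau> (2 * i)) * inverse (1 - X (\<tau> (2 * i)))) *
        (Q (\<sigma> (\<tau> (2 * i + 1))) (\<tau> (2 * i + 1)) * inverse (1 - X (\<tau> (2 * i + 1))))) * R"
      unfolding R_def by (rule prod_lessThan_pairs)
    also have "\<dots> * (\<Prod>i<n div 2. mls_schur.squot (X (\<tau> (2 * i))) (X (\<tau> (2 * i + 1)))) = (\<Prod>i<n div 2. P i) * R"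
      unfolding P_def kappa_def mls_schur.squot_def X_def prod.distrib by (simp only: mult_ac)
    finally have "CT_mls (G \<sigma> \<tau>) = CT_mls ((\<Prod>i<n div 2. P i) * R)" by (rule arg_cong)
    also have "\<dots> = CT_mls (\<Prod>i<n div 2. P i) * CT_mls R"
    proof (rule CT_mult_disjoint[OF _ vars_R])
      show "vars_in (\<Union>i<n div 2. V i) (\<Prod>i<n div 2. P i)"
        by (rule vars_in_prod, rule vars_in_mono[OF vars_P]) auto
      show "(\<Union>i<n div 2. V i) \<inter> V' = {}" by (auto simp: V_def V'_def inj elim!: oddE)
    qed
    also have "CT_mls (\<Prod>i<n div 2. P i) = (\<Prod>i<n div 2. CT_mls (P i))"
    proof (rule CT_prod_disjoint[OF _ vars_P])
      fix i j :: nat assume "i \<noteq> j"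
      then show "V i \<inter> V j = {}" using odd_neq_even unfolding V_def by (auto simp: inj)
    qed simp
    also have "\<dots> = (\<Prod>i<n div 2. pair_ct m (\<sigma> (\<tau> (2 * i))) (\<sigma> (\<tau> (2 * i + 1))))"
      unfolding P_def Q_def U_def X_def by (intro prod.cong refl CT_pair) (simp add: inj)
    also have "CT_mls R = (if odd n then 2 ^ (m + \<sigma> (\<tau> (n - 1))) else 1)"
      unfolding R_def Q_def U_def X_def using CT_single by (simp add: CT_simps)
    finally show ?thesis by (simp only: L_term_def o_apply)
  qed
  have "(\<Sum>\<sigma>\<in>?S. \<Sum>\<tau>\<in>?S. of_int (sign \<sigma> * sign \<tau>) * CT_mls (G \<sigma> \<tau>)) =
      (\<Sum>\<tau>\<in>?S. \<Sum>\<sigma>\<in>?S. of_int (sign \<sigma>) * of_int (sign \<tau>) * L_term n m (\<sigma> \<circ> \<tau>))"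
    by (subst sum.swap) (intro sum.cong refl, simp add: CT_G)
  also have "\<dots> = fact n * (\<Sum>\<rho>\<in>?S. of_int (sign \<rho>) * L_term n m \<rho>)"
    by (subst double_perm_sum) simp_all
  finally have "of_nat c * CT_mls W = of_int s * (fact n * (\<Sum>\<rho>\<in>?S. of_int (sign \<rho>) * L_term n m \<rho>))"
    by (simp only: cW)
  moreover have "L_const n m = 1 / fact n * CT_mls W" by (simp add: L_const_def W_def)
  then have "CT_mls W = fact n * L_const n m" by simp
  ultimately have "fact n * (of_nat c * L_const n m) =
      fact n * (of_int s * (\<Sum>\<rho>\<in>?S. of_int (sign \<rho>) * L_term n m \<rho>))"
    by (simp only: mult_ac)
  then have "of_nat c * L_const n m = of_int s * (\<Sum>\<rho>\<in>?S. of_int (sign \<rho>) * L_term n m \<rho>)"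
    by simp
  then show ?thesis by (simp add: c_def s_def)
qed

section \<open>Laurent polynomials in one variable\<close>

no_notation index_mat (infixl "$$" 100)
notation fls_nth (infixl "$$" 75)

text \<open>Links a Laurent polynomial with its values at nonzero rationals, so that identities can
  be checked pointwise; the value of \<open>F\<close> at 0 is left free.\<close>

definition laurent_rep :: "rat fls \<Rightarrow> (rat \<Rightarrow> rat) \<Rightarrow> bool" where
  "laurent_rep f F \<longleftrightarrow> (\<exists>N p. f = fls_shift (int N) (fps_to_fls (fps_of_poly p)) \<and>
     (\<forall>t. t \<noteq> 0 \<longrightarrow> F t = poly p t / t ^ N))"

lemma laurent_rep_mult:
  assumes "laurent_rep f F" "laurent_rep g G"
  shows "laurent_rep (f * g) (\<lambda>t. F t * G t)"
proof -
  obtain N p where 1: "f = fls_shift (int N) (fps_to_fls (fps_of_poly p))"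
    "\<And>t. t \<noteq> 0 \<Longrightarrow> F t = poly p t / t ^ N" using assms(1) by (auto simp: laurent_rep_def)
  obtain M q where 2: "g = fls_shift (int M) (fps_to_fls (fps_of_poly q))"
    "\<And>t. t \<noteq> 0 \<Longrightarrow> G t = poly q t / t ^ M" using assms(2) by (auto simp: laurent_rep_def)
  show ?thesis unfolding laurent_rep_def
    by (rule exI[of _ "N + M"], rule exI[of _ "p * q"])
       (simp add: 1 2 fls_shifted_times_simps fls_times_fps_to_fls fps_of_poly_mult power_add add.commute)
qed

lemma laurent_rep_add:
  assumes "laurent_rep f F" "laurent_rep g G"
  shows "laurent_rep (f + g) (\<lambda>t. F t + G t)"
proof -
  obtain N p where 1: "f = fls_shift (int N) (fps_to_fls (fps_of_poly p))"
    "\<And>t. t \<noteq> 0 \<Longrightarrow> F t = poly p t / t ^ N" using assms(1) by (auto simp: laurent_rep_def)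
  obtain M q where 2: "g = fls_shift (int M) (fps_to_fls (fps_of_poly q))"
    "\<And>t. t \<noteq> 0 \<Longrightarrow> G t = poly q t / t ^ M" using assms(2) by (auto simp: laurent_rep_def)
  \<comment> \<open>Numerator and denominator are multiplied by the same power of the variable to
    reach a common denominator.\<close>
  have shift: "fls_shift (int K + int L) (fps_to_fls (fps_of_poly (monom 1 L * r)))
      = fls_shift (int K) (fps_to_fls (fps_of_poly r))" for K L and r :: "rat poly"
    by (rule fls_eqI) (auto simp: coeff_monom_mult fps_of_poly_nth nat_add_distrib intro!: arg_cong[of _ _ "coeff r"])
  show ?thesis unfolding laurent_rep_def
    by (rule exI[of _ "N + M"], rule exI[of _ "monom 1 M * p + monom 1 N * q"])
       (use shift[of N M p] shift[of M N q] in
         \<open>simp add: 1 2 fps_of_poly_add poly_monom power_add field_simps\<close>)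
qed

lemma laurent_rep_const: "laurent_rep (fls_const c) (\<lambda>t. c)"
  unfolding laurent_rep_def
  by (rule exI[of _ 0], rule exI[of _ "[:c:]"]) (simp add: fps_of_poly_const fps_const_to_fls)

lemma laurent_rep_X: "laurent_rep fls_X (\<lambda>t. t)" "laurent_rep (inverse fls_X) (\<lambda>t. 1 / t)"
proof -
  show "laurent_rep fls_X (\<lambda>t. t)" unfolding laurent_rep_def
    by (rule exI[of _ 0], rule exI[of _ "[:0, 1:]"]) simp
  show "laurent_rep (inverse fls_X) (\<lambda>t. 1 / t)" unfolding laurent_rep_def
    by (rule exI[of _ 1], rule exI[of _ 1]) (simp add: fls_inverse_X fls_X_inv_conv_shift_1)
qed

lemma laurent_rep_diff:
  assumes "laurent_rep f F" "laurent_rep g G"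
  shows "laurent_rep (f - g) (\<lambda>t. F t - G t)"
  using laurent_rep_add[OF assms(1) laurent_rep_mult[OF laurent_rep_const[of "- 1"] assms(2)]]
  by (simp add: fls_const_uminus)

lemma laurent_rep_numeral:
  "laurent_rep 1 (\<lambda>t. 1)" "laurent_rep 0 (\<lambda>t. 0)" "laurent_rep (numeral k) (\<lambda>t. numeral k)"
  using laurent_rep_const[of 1] laurent_rep_const[of 0] laurent_rep_const[of "numeral k"]
  unfolding fls_const_1 fls_const_0 fls_const_numeral by this

lemma laurent_rep_power: "laurent_rep f F \<Longrightarrow> laurent_rep (f ^ k) (\<lambda>t. F t ^ k)"
  by (induction k) (auto intro: laurent_rep_numeral laurent_rep_mult)

lemma laurent_rep_sum:
  "(\<And>s. s \<in> S \<Longrightarrow> laurent_rep (f s) (F s)) \<Longrightarrow> laurent_rep (\<Sum>s\<in>S. f s) (\<lambda>t. \<Sum>s\<in>S. F s t)"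
  by (induction S rule: infinite_finite_induct) (auto intro: laurent_rep_numeral laurent_rep_add)

text \<open>The numerator would otherwise be a nonzero polynomial with infinitely many
  roots.\<close>

lemma laurent_rep_zero:
  assumes "laurent_rep f F" "infinite U" "0 \<notin> U" "\<And>t. t \<in> U \<Longrightarrow> F t = 0"
  shows "f = 0"
proof -
  obtain N p where 1: "f = fls_shift (int N) (fps_to_fls (fps_of_poly p))"
    "\<And>t. t \<noteq> 0 \<Longrightarrow> F t = poly p t / t ^ N" using assms(1) by (auto simp: laurent_rep_def)
  have "poly p t = 0" if "t \<in> U" for t
  proof -
    have "t \<noteq> 0" using that assms(3) by blast
    then show ?thesis using 1(2)[of t] assms(4)[OF that] by simp
  qed
  then have "U \<subseteq> {t. poly p t = 0}" by blast
  then have "p = 0" using poly_roots_finite[of p] assms(2) finite_subset by blast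
  then show ?thesis by (simp add: 1)
qed

lemma laurent_rep_eventually_zero:
  assumes "laurent_rep f F"
  shows "\<forall>\<^sub>F E in sequentially. f $$ int E = 0 \<and> f $$ (- int E) = 0"
proof -
  obtain N p where 1: "f = fls_shift (int N) (fps_to_fls (fps_of_poly p))"
    using assms(1) by (auto simp: laurent_rep_def)
  have "f $$ int E = 0 \<and> f $$ (- int E) = 0" if "E > degree p + N" for E
    using that by (auto simp: 1 coeff_eq_0 nat_add_distrib)
  then show ?thesis by (intro eventually_sequentiallyI[of "Suc (degree p + N)"]) auto
qed

section \<open>The sign functional in one variable\<close>

text \<open>
  The functional \<open>M(f) = \<Sum>\<^sub>e sgn(e) [u\<^sup>e] f\<close> on Laurent polynomials, as the eventual value of
  truncated sums, so that no bound on the support has to be carried along.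
\<close>

definition sgn_trunc :: "nat \<Rightarrow> rat fls \<Rightarrow> rat" where
  "sgn_trunc E f = (\<Sum>e=1..E. f $$ int e - f $$ (- int e))"

definition has_sgn_sum :: "rat fls \<Rightarrow> rat \<Rightarrow> bool" where
  "has_sgn_sum f v \<longleftrightarrow> (\<forall>\<^sub>F E in sequentially. sgn_trunc E f = v)"

lemma has_sgn_sum_unique: "has_sgn_sum f v \<Longrightarrow> has_sgn_sum f w \<Longrightarrow> v = w"
  unfolding has_sgn_sum_def by (drule (1) eventually_conj) (auto dest: eventually_happens)

lemma has_sgn_sum_0: "has_sgn_sum 0 0"
  by (simp add: has_sgn_sum_def sgn_trunc_def)

lemma has_sgn_sum_add: "has_sgn_sum f v \<Longrightarrow> has_sgn_sum g w \<Longrightarrow> has_sgn_sum (f + g) (v + w)"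
  unfolding has_sgn_sum_def
  by (erule (1) eventually_elim2) (auto simp: sgn_trunc_def sum.distrib sum_subtractf)

lemma has_sgn_sum_scale: "has_sgn_sum f v \<Longrightarrow> has_sgn_sum (fls_const c * f) (c * v)"
  unfolding has_sgn_sum_def
  by (erule eventually_mono) (auto simp: sgn_trunc_def sum_distrib_left algebra_simps)

lemma has_sgn_sum_sum:
  "(\<And>s. s \<in> S \<Longrightarrow> has_sgn_sum (f s) (v s)) \<Longrightarrow> has_sgn_sum (\<Sum>s\<in>S. f s) (\<Sum>s\<in>S. v s)"
  by (induction S rule: infinite_finite_induct) (auto intro: has_sgn_sum_0 has_sgn_sum_add)

lemma has_sgn_sum_monom: "has_sgn_sum (fls_X ^ i * inverse fls_X ^ j) (of_int (sgn (int i - int j)))"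
proof -
  have nth: "(fls_X ^ i * inverse fls_X ^ j :: rat fls) $$ e = (if e = int i - int j then 1 else 0)" for e
    unfolding fls_inverse_X
    by (subst mult.commute) (auto simp: fls_X_inv_power_times_conv_shift fls_X_power_nth)
  have "sgn_trunc E (fls_X ^ i * inverse fls_X ^ j) = of_int (sgn (int i - int j))" if E: "E \<ge> i + j" for E
  proof -
    consider "i < j" | "i = j" | "j < i" by linarith
    then show ?thesis
    proof cases
      case 1
      have "sgn_trunc E (fls_X ^ i * inverse fls_X ^ j) = (\<Sum>e=1..E. if e = j - i then - 1 else 0)"
        unfolding sgn_trunc_def nth by (intro sum.cong refl) (use 1 in auto)
      moreover have "1 \<le> j - i" "j - i \<le> E" using 1 E by linarith+
      ultimately show ?thesis using 1 by (simp add: sgn_if)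
    next
      case 2
      then show ?thesis unfolding sgn_trunc_def nth by simp
    next
      case 3
      have "sgn_trunc E (fls_X ^ i * inverse fls_X ^ j) = (\<Sum>e=1..E. if e = i - j then 1 else 0)"
        unfolding sgn_trunc_def nth by (intro sum.cong refl) (use 3 in auto)
      moreover have "1 \<le> i - j" "i - j \<le> E" using 3 E by linarith+
      ultimately show ?thesis using 3 by (simp add: sgn_if)
    qed
  qed
  then show ?thesis unfolding has_sgn_sum_def by (auto intro: eventually_sequentiallyI)
qed

text \<open>The sum telescopes, leaving only coefficients near the constant term.\<close>

lemma has_sgn_sum_antisym:
  assumes "laurent_rep \<psi> \<Psi>"
  shows "has_sgn_sum ((fls_X - inverse fls_X) * \<psi>) ((z_lp * \<psi>) $$ 0)"
proof -
  have z: "(z_lp * \<psi>) $$ 0 = \<psi> $$ (- 1) + 2 * \<psi> $$ 0 + \<psi> $$ 1"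
  proof -
    have "z_lp * \<psi> = fls_shift (- 1) \<psi> + (\<psi> + \<psi>) + fls_shift 1 \<psi>"
      unfolding z_lp_def fls_inverse_X distrib_right fls_X_times_conv_shift(1)
        fls_X_inv_times_conv_shift(1) mult_2 ..
    then show ?thesis by simp
  qed
  define D where "D = (fls_X - inverse fls_X) * \<psi>"
  have d: "D $$ e = \<psi> $$ (e - 1) - \<psi> $$ (e + 1)" for e
    unfolding D_def fls_inverse_X left_diff_distrib fls_X_times_conv_shift(1)
      fls_X_inv_times_conv_shift(1) by simp
  have tele: "sgn_trunc E D = \<psi> $$ (- 1) + 2 * \<psi> $$ 0 + \<psi> $$ 1
      - (\<psi> $$ int E + \<psi> $$ int (Suc E) + \<psi> $$ (- int E) + \<psi> $$ (- int (Suc E)))" for E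
    by (induction E) (simp_all add: sgn_trunc_def d algebra_simps)
  note ev = laurent_rep_eventually_zero[OF assms]
  \<comment> \<open>The truncated sums leave coefficients at \<open>E\<close> and at
    \<open>Suc E\<close>, so both must have died out.\<close>
  have "\<forall>\<^sub>F E in sequentially. \<psi> $$ int (Suc E) = 0 \<and> \<psi> $$ (- int (Suc E)) = 0"
    using ev by (subst eventually_sequentially_Suc[of "\<lambda>E. \<psi> $$ int E = 0 \<and> \<psi> $$ (- int E) = 0"])
  with ev show ?thesis unfolding has_sgn_sum_def D_def[symmetric]
    by (rule eventually_elim2) (simp add: tele z)
qed

text \<open>Evaluations at \<open>t i\<close> are traded for the values \<open>M\<close>, one
  variable at a time. With the other variables fixed, the relation \<open>z\<close> is linear in
  functions of one variable, and \<open>H\<close> says that \<open>M\<close> respects such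
  relations.\<close>

lemma multilinear_transfer:
  fixes F :: "'s \<Rightarrow> nat \<Rightarrow> 'b \<Rightarrow> 'a::comm_ring_1"
  assumes H: "\<And>i d. i < k \<Longrightarrow> (\<And>t. t \<in> U \<Longrightarrow> (\<Sum>s\<in>S. d s * F s i t) = 0) \<Longrightarrow> (\<Sum>s\<in>S. d s * M s i) = 0"
    and z: "\<And>t. (\<And>i. i < k \<Longrightarrow> t i \<in> U) \<Longrightarrow> (\<Sum>s\<in>S. c s * (\<Prod>i<k. F s i (t i))) = 0"
    and "U \<noteq> {}"
  shows "(\<Sum>s\<in>S. c s * (\<Prod>i<k. M s i)) = 0"
proof -
  have "j \<le> k \<Longrightarrow> (\<And>i. i < k \<Longrightarrow> t i \<in> U) \<Longrightarrow>
      (\<Sum>s\<in>S. c s * (\<Prod>i<j. M s i) * (\<Prod>i\<in>{j..<k}. F s i (t i))) = 0" for j and t :: "nat \<Rightarrow> 'b"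
  proof (induction j arbitrary: t)
    case 0
    then show ?case using z[of t] by (simp add: atLeast0LessThan)
  next
    case (Suc j)
    have "(\<Sum>s\<in>S. (c s * (\<Prod>i<j. M s i) * (\<Prod>i\<in>{Suc j..<k}. F s i (t i))) * F s j x) = 0" if "x \<in> U" for x
    proof -
      have "(\<Sum>s\<in>S. c s * (\<Prod>i<j. M s i) * (\<Prod>i\<in>{j..<k}. F s i ((t(j := x)) i))) = 0"
        using Suc.prems that by (intro Suc.IH) auto
      moreover have "(\<Prod>i\<in>{j..<k}. F s i ((t(j := x)) i)) = F s j x * (\<Prod>i\<in>{Suc j..<k}. F s i (t i))" for s
        using Suc.prems(1) by (subst prod.atLeast_Suc_lessThan) auto
      ultimately show ?thesis by (simp add: mult_ac)
    qed
    from H[OF _ this] Suc.prems(1)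
    have "(\<Sum>s\<in>S. (c s * (\<Prod>i<j. M s i) * (\<Prod>i\<in>{Suc j..<k}. F s i (t i))) * M s j) = 0" by simp
    then show ?case by (simp add: mult_ac)
  qed
  \<comment> \<open>At \<open>j = k\<close> no evaluation is left, so any point of \<open>U\<close>
    will do.\<close>
  from this[of k "\<lambda>_. SOME u. u \<in> U"] assms(3) show ?thesis by (simp add: some_in_eq)
qed

text \<open>An identity between functions on \<open>U\<close> carries over to the sign functional
  applied in each variable. Both sides enter one sum over \<open>S <+> R\<close>, the right one
  negated.\<close>

lemma sgn_sum_transfer:
  fixes F :: "'s \<Rightarrow> nat \<Rightarrow> rat \<Rightarrow> rat" and G :: "'r \<Rightarrow> nat \<Rightarrow> rat \<Rightarrow> rat"
  assumes fin: "finite S" "finite R"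
    and S: "\<And>s i. s \<in> S \<Longrightarrow> i < k \<Longrightarrow> laurent_rep (f s i) (F s i) \<and> has_sgn_sum (f s i) (M s i)"
    and R: "\<And>r i. r \<in> R \<Longrightarrow> i < k \<Longrightarrow> laurent_rep (g r i) (G r i) \<and> has_sgn_sum (g r i) (N r i)"
    and U: "infinite U" "0 \<notin> U"
    and eq: "\<And>t. (\<And>i. i < k \<Longrightarrow> t i \<in> U) \<Longrightarrow>
      (\<Sum>s\<in>S. c s * (\<Prod>i<k. F s i (t i))) = (\<Sum>r\<in>R. d r * (\<Prod>i<k. G r i (t i)))"
  shows "(\<Sum>s\<in>S. c s * (\<Prod>i<k. M s i)) = (\<Sum>r\<in>R. d r * (\<Prod>i<k. N r i))"
proof -
  let ?T = "S <+> R"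
  have T: "laurent_rep (case_sum f g s i) (case_sum F G s i) \<and> has_sgn_sum (case_sum f g s i) (case_sum M N s i)"
    if "s \<in> ?T" "i < k" for s i
    using that S R by auto
  have split: "(\<Sum>s\<in>?T. h s) = (\<Sum>s\<in>S. h (Inl s)) + (\<Sum>r\<in>R. h (Inr r))" for h :: "_ \<Rightarrow> rat"
    using fin by (simp add: sum.Plus)
  have "(\<Sum>s\<in>?T. case_sum c (\<lambda>r. - d r) s * (\<Prod>i<k. case_sum M N s i)) = 0"
  proof (rule multilinear_transfer[where F = "case_sum F G" and U = U])
    fix i and e :: "_ \<Rightarrow> rat"
    assume i: "i < k" and z: "\<And>t. t \<in> U \<Longrightarrow> (\<Sum>s\<in>?T. e s * case_sum F G s i t) = 0"
    \<comment> \<open>A linear relation between the functions gives a vanishing Laurent polynomial,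
      whose sign sum is 0.\<close>
    let ?f = "\<Sum>s\<in>?T. fls_const (e s) * case_sum f g s i"
    have "laurent_rep ?f (\<lambda>t. \<Sum>s\<in>?T. e s * case_sum F G s i t)"
      using T i by (intro laurent_rep_sum laurent_rep_mult laurent_rep_const) auto
    then have "?f = 0" using U z by (rule laurent_rep_zero)
    moreover have "has_sgn_sum ?f (\<Sum>s\<in>?T. e s * case_sum M N s i)"
      using T i by (intro has_sgn_sum_sum has_sgn_sum_scale) auto
    ultimately show "(\<Sum>s\<in>?T. e s * case_sum M N s i) = 0"
      using has_sgn_sum_0 has_sgn_sum_unique by metis
  next
    fix t assume "\<And>i. i < k \<Longrightarrow> t i \<in> U"
    then show "(\<Sum>s\<in>?T. case_sum c (\<lambda>r. - d r) s * (\<Prod>i<k. case_sum F G s i (t i))) = 0"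
      using eq[of t] by (simp add: split sum_negf)
  next
    show "U \<noteq> {}" using U(1) by auto
  qed
  then show ?thesis by (simp add: split sum_negf)
qed

section \<open>The determinant\<close>

lemma diff_prod_pairs_even:
  "diff_prod (2 * k) y = (\<Prod>i<k. y (2 * i) - y (2 * i + 1)) *
     (\<Prod>j<k. \<Prod>i<j. (y (2 * i) - y (2 * j)) * (y (2 * i) - y (2 * j + 1)) *
       ((y (2 * i + 1) - y (2 * j)) * (y (2 * i + 1) - y (2 * j + 1))))"
proof (induction k)
  case 0
  then show ?case by (simp add: diff_prod_def)
next
  case (Suc k)
  have p: "(\<Prod>i<2 * k. h i) = (\<Prod>i<k. h (2 * i) * h (2 * i + 1))" for h :: "nat \<Rightarrow> 'a"
    using prod_lessThan_pairs[of h "2 * k"] by simp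
  have "diff_prod (2 * Suc k) y = diff_prod (2 * k) y * (\<Prod>i<2 * k. y i - y (2 * k)) *
      ((\<Prod>i<2 * k. y i - y (2 * k + 1)) * (y (2 * k) - y (2 * k + 1)))"
    by (simp add: diff_prod_def)
  also have "\<dots> = (diff_prod (2 * k) y * (y (2 * k) - y (2 * k + 1))) *
      (\<Prod>i<k. (y (2 * i) - y (2 * k)) * (y (2 * i) - y (2 * k + 1)) *
       ((y (2 * i + 1) - y (2 * k)) * (y (2 * i + 1) - y (2 * k + 1))))"
    unfolding p prod.distrib by (simp only: mult_ac)
  finally show ?case unfolding Suc.IH by (simp only: prod.lessThan_Suc mult_ac)
qed

lemma diff_prod_pairs_odd:
  "diff_prod (2 * k + 1) y = diff_prod (2 * k) y * (\<Prod>i<k. (y (2 * i) - y (2 * k)) * (y (2 * i + 1) - y (2 * k)))"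
  using prod_lessThan_pairs[of "\<lambda>i. y i - y (2 * k)" "2 * k"] by (simp add: diff_prod_def)

text \<open>The right side contains \<open>a\<close>, \<open>b\<close> only through
  \<open>a + b\<close> and \<open>a * b\<close>, and likewise \<open>c\<close>, \<open>d\<close>.
  For \<open>g(t)\<close> and \<open>g(1/t)\<close> these are polynomials in
  \<open>z\<close>.\<close>

lemma resultant_quadratics:
  fixes a b c d :: "'a::comm_ring_1"
  shows "(a - c) * (a - d) * ((b - c) * (b - d)) =
    (a * b) ^ 2 - (c + d) * (a * b) * (a + b) + (c * d) * ((a + b) ^ 2 - 2 * (a * b)) +
    (c + d) ^ 2 * (a * b) - (c + d) * (c * d) * (a + b) + (c * d) ^ 2"
  by (simp add: algebra_simps power2_eq_square)

lemma prod_pairs_const: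
  fixes z :: "nat \<Rightarrow> 'a::comm_monoid_mult"
  shows "(\<Prod>j<k. \<Prod>i<j. z i * z j) = (\<Prod>i<k. z i ^ (k - 1))"
proof (induction k)
  case (Suc k)
  have "(\<Prod>i<k. z i ^ (k - 1)) * (\<Prod>i<k. z i) = (\<Prod>i<k. z i ^ k)"
    unfolding prod.distrib[symmetric]
    by (intro prod.cong refl) (metis lessThan_iff mult.commute not_less_zero power_eq_if)
  moreover have "(\<Prod>j<Suc k. \<Prod>i<j. z i * z j) = (\<Prod>i<k. z i ^ (k - 1)) * (\<Prod>i<k. z i) * z k ^ k"
    unfolding prod.lessThan_Suc Suc.IH by (simp add: prod.distrib mult.assoc)
  ultimately show ?case by simp
qed simp

definition zt :: "rat \<Rightarrow> rat" where "zt t = t + 2 + 1 / t"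

lemma g_fun_sum_prod:
  fixes t :: rat
  assumes "t \<noteq> 0"
  shows "g_fun t * g_fun (1 / t) = zt t" "g_fun t + g_fun (1 / t) = zt t ^ 2 - 3 * zt t"
    "g_fun t - g_fun (1 / t) = (t - 1 / t) * (zt t - 1)"
    "(1 + t) * (1 + 1 / t) = zt t"
proof -
  \<comment> \<open>With \<open>u\<close> for \<open>1 / t\<close> the claims become polynomial
    identities modulo \<open>t * u = 1\<close>.\<close>
  define u where "u = 1 / t"
  have tu: "t * u = 1" using assms by (simp add: u_def)
  have red: "t * (u * x) = x" for x using tu by (metis mult.assoc mult_1_left)
  show "g_fun t * g_fun (1 / t) = zt t" "g_fun t + g_fun (1 / t) = zt t ^ 2 - 3 * zt t"
    "g_fun t - g_fun (1 / t) = (t - 1 / t) * (zt t - 1)"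
    "(1 + t) * (1 + 1 / t) = zt t"
    unfolding zt_def u_def[symmetric] g_fun_def
    by (simp_all add: algebra_simps power2_eq_square tu red)
qed

definition odd_factor :: "nat \<Rightarrow> 'a::comm_ring_1 \<Rightarrow> 'a" where
  "odd_factor n z = (if odd n then (2 * z + 1) * (4 - z) else 1)"

text \<open>The unpaired variable contributes the point \<open>g(1) = 2\<close>; these are the
  differences of a pair from it.\<close>

lemma g_fun_minus_2:
  fixes t :: rat
  assumes "t \<noteq> 0"
  shows "(g_fun t - 2) * (g_fun (1 / t) - 2) = (2 * zt t + 1) * (4 - zt t)"
proof -
  have "(g_fun t - 2) * (g_fun (1 / t) - 2) = g_fun t * g_fun (1 / t) - 2 * (g_fun t + g_fun (1 / t)) + 4"
    by (simp add: algebra_simps)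
  then show ?thesis unfolding g_fun_sum_prod[OF assms] by (simp add: algebra_simps power2_eq_square)
qed

text \<open>
  With \<open>g = g(t)\<close> one has \<open>(1 + g)\<^sup>3 / g\<^sup>2 = (z - 1)\<^sup>3 / z\<close>, which is unchanged under \<open>t \<mapsto> 1/t\<close>;
  this is why the resultant splits off a second difference.
\<close>

lemma g_fun_resultant:
  fixes t u :: rat
  assumes "t \<noteq> 0" "u \<noteq> 0" "zt t \<noteq> 0" "zt u \<noteq> 0"
  shows "(g_fun t - g_fun u) * (g_fun t - g_fun (1 / u)) *
      ((g_fun (1 / t) - g_fun u) * (g_fun (1 / t) - g_fun (1 / u))) =
    (zt t - zt u) * ((zt t - 1) ^ 3 / zt t - (zt u - 1) ^ 3 / zt u) * (zt t * zt u)"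
proof -
  have "((zt t - 1) ^ 3 / zt t - (zt u - 1) ^ 3 / zt u) * (zt t * zt u)
      = (zt t - 1) ^ 3 * zt u - (zt u - 1) ^ 3 * zt t"
    using assms by (simp add: field_simps)
  moreover have "(g_fun t - g_fun u) * (g_fun t - g_fun (1 / u)) *
      ((g_fun (1 / t) - g_fun u) * (g_fun (1 / t) - g_fun (1 / u))) =
      (zt t - zt u) * ((zt t - 1) ^ 3 * zt u - (zt u - 1) ^ 3 * zt t)"
    unfolding resultant_quadratics g_fun_sum_prod[OF assms(1)] g_fun_sum_prod[OF assms(2)]
    by (simp add: algebra_simps power2_eq_square power3_eq_cube)
  ultimately show ?thesis by (simp only: mult.assoc)
qed

text \<open>Within a pair the difference is \<open>(t - 1/t) (z - 1)\<close>. Across two pairs the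
  resultant splits into differences of \<open>z\<close> and of \<open>w\<close>, with factors
  \<open>z i * z j\<close> that collect to the power \<open>k - 1\<close>. Odd \<open>n\<close> adds
  the differences from 2.\<close>

lemma diff_prod_g_fun:
  fixes t :: "nat \<Rightarrow> rat"
  assumes t: "\<And>i. i < k \<Longrightarrow> t i \<noteq> 0 \<and> zt (t i) \<noteq> 0"
    and y: "\<And>i. i < k \<Longrightarrow> y (2 * i) = g_fun (t i)" "\<And>i. i < k \<Longrightarrow> y (2 * i + 1) = g_fun (1 / t i)" "y (2 * k) = 2"
    and n: "k = n div 2"
  shows "diff_prod n y = (\<Prod>i<k. (t i - 1 / t i) * (zt (t i) - 1) * odd_factor n (zt (t i))) *
    (alt_powers k (\<lambda>i. zt (t i)) * alt_powers k (\<lambda>i. (zt (t i) - 1) ^ 3 / zt (t i)) *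
     (\<Prod>i<k. zt (t i) ^ (k - 1)))"
proof -
  let ?z = "\<lambda>i. zt (t i)" and ?w = "\<lambda>i. (zt (t i) - 1) ^ 3 / zt (t i)"
  have "diff_prod (2 * k) y = (\<Prod>i<k. (t i - 1 / t i) * (zt (t i) - 1)) *
      (\<Prod>j<k. \<Prod>i<j. (?z i - ?z j) * (?w i - ?w j) * (?z i * ?z j))"
    unfolding diff_prod_pairs_even
  proof (rule arg_cong2[where f = "(*)"])
    show "(\<Prod>i<k. y (2 * i) - y (2 * i + 1)) = (\<Prod>i<k. (t i - 1 / t i) * (zt (t i) - 1))"
    proof (rule prod.cong[OF refl])
      fix i assume "i \<in> {..<k}"
      then have i: "i < k" by simp
      show "y (2 * i) - y (2 * i + 1) = (t i - 1 / t i) * (zt (t i) - 1)"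
        unfolding y(1,2)[OF i] by (rule g_fun_sum_prod(3)[OF t[OF i, THEN conjunct1]])
    qed
    show "(\<Prod>j<k. \<Prod>i<j. (y (2 * i) - y (2 * j)) * (y (2 * i) - y (2 * j + 1)) *
       ((y (2 * i + 1) - y (2 * j)) * (y (2 * i + 1) - y (2 * j + 1)))) =
      (\<Prod>j<k. \<Prod>i<j. (?z i - ?z j) * (?w i - ?w j) * (?z i * ?z j))"
    proof (rule prod.cong[OF refl], rule prod.cong[OF refl])
      fix i j assume "j \<in> {..<k}" "i \<in> {..<j}"
      then have i: "i < k" and j: "j < k" by auto
      show "(y (2 * i) - y (2 * j)) * (y (2 * i) - y (2 * j + 1)) *
         ((y (2 * i + 1) - y (2 * j)) * (y (2 * i + 1) - y (2 * j + 1))) =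
        (?z i - ?z j) * (?w i - ?w j) * (?z i * ?z j)"
        unfolding y(1,2)[OF i] y(1,2)[OF j] by (rule g_fun_resultant) (use t[OF i] t[OF j] in auto)
    qed
  qed
  also have "(\<Prod>j<k. \<Prod>i<j. (?z i - ?z j) * (?w i - ?w j) * (?z i * ?z j)) =
      diff_prod k ?z * diff_prod k ?w * (\<Prod>i<k. ?z i ^ (k - 1))"
    unfolding prod_pairs_const[symmetric] diff_prod_def prod.distrib by (simp only: mult_ac)
  \<comment> \<open>Both products carry the same sign relative to their alternants, and it
    cancels.\<close>
  also have "diff_prod k ?z * diff_prod k ?w = alt_powers k ?z * alt_powers k ?w"
  proof -
    define s :: rat where "s = (\<Prod>j<k. (- 1) ^ j)"
    have "s * s = 1" unfolding s_def prod.distrib[symmetric] by (simp flip: power_mult_distrib)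
    have "s * diff_prod k ?z * (s * diff_prod k ?w) = s * s * (diff_prod k ?z * diff_prod k ?w)"
      by (simp only: mult_ac)
    also have "\<dots> = diff_prod k ?z * diff_prod k ?w" unfolding \<open>s * s = 1\<close> by (rule mult_1_left)
    finally show ?thesis unfolding alt_powers_eq s_def by (rule sym)
  qed
  finally have ev: "diff_prod (2 * k) y = (\<Prod>i<k. (t i - 1 / t i) * (zt (t i) - 1)) *
      (alt_powers k ?z * alt_powers k ?w * (\<Prod>i<k. ?z i ^ (k - 1)))" .
  show ?thesis
  proof (cases "even n")
    case True
    then have "n = 2 * k" by (simp add: n)
    then show ?thesis using ev by (simp add: odd_factor_def)
  next
    case False
    then have nk: "n = 2 * k + 1" by (simp add: n)
    have "(\<Prod>i<k. (y (2 * i) - y (2 * k)) * (y (2 * i + 1) - y (2 * k))) = (\<Prod>i<k. odd_factor n (zt (t i)))"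
      by (intro prod.cong refl) (use t False in \<open>simp only: y g_fun_minus_2 odd_factor_def lessThan_iff if_True not_False_eq_True\<close>)
    then have "diff_prod n y = diff_prod (2 * k) y * (\<Prod>i<k. odd_factor n (zt (t i)))"
      unfolding nk diff_prod_pairs_odd by simp
    then show ?thesis unfolding ev prod.distrib by (simp only: mult_ac)
  qed
qed

section \<open>From the sign functional to the determinant\<close>

definition pair_fls :: "nat \<Rightarrow> nat \<Rightarrow> nat \<Rightarrow> rat fls" where
  "pair_fls m a b = ((1 + fls_X) ^ m * g_fun fls_X ^ a) * ((1 + inverse fls_X) ^ m * g_fun (inverse fls_X) ^ b)"

lemma laurent_rep_pair_fls:
  "laurent_rep (pair_fls m a b) (\<lambda>t. ((1 + t) ^ m * g_fun t ^ a) * ((1 + 1 / t) ^ m * g_fun (1 / t) ^ b))"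
  unfolding pair_fls_def g_fun_def
  by (intro laurent_rep_mult laurent_rep_power laurent_rep_add laurent_rep_numeral laurent_rep_X)

lemma has_sgn_sum_pair_fls: "has_sgn_sum (pair_fls m a b) (pair_ct m a b)"
proof -
  have "pair_fls m a b = (\<Sum>i\<le>m + a. \<Sum>j\<le>m + b. fls_const (of_nat ((m + a) choose i) * of_nat ((m + b) choose j)) *
      (fls_X ^ (i + a) * inverse fls_X ^ (j + b)))"
    unfolding pair_fls_def binomial_g_fun sum_product fls_of_nat
    by (intro sum.cong refl) (simp only: fls_const_mult_const[symmetric] mult_ac)
  then show ?thesis unfolding pair_ct_def
    by (simp only:) (intro has_sgn_sum_sum has_sgn_sum_scale has_sgn_sum_monom)
qed

text \<open>What one variable retains without its factor \<open>u - 1/u\<close>: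
  \<open>z - 1\<close> from the difference within the pair, \<open>z^m\<close>, and
  \<open>z^p w^r z^(k-1)\<close> with the denominator \<open>z^r\<close> cancelled. For
  \<open>r < k\<close> the subtraction is not truncated.\<close>

definition det_entry :: "nat \<Rightarrow> nat \<Rightarrow> nat \<Rightarrow> nat \<Rightarrow> nat \<Rightarrow> rat fls" where
  "det_entry n m k r p = (z_lp - 1) * (z_lp ^ m * (z_lp ^ (p + k - 1 - r) * (z_lp - 1) ^ (3 * r) * odd_factor n z_lp))"

lemma laurent_rep_z_lp: "laurent_rep z_lp zt"
  unfolding z_lp_def zt_def[abs_def] by (intro laurent_rep_add laurent_rep_numeral laurent_rep_X)

lemma laurent_rep_det_entry:
  "laurent_rep (det_entry n m k r p)
    (\<lambda>t. (zt t - 1) * (zt t ^ m * (zt t ^ (p + k - 1 - r) * (zt t - 1) ^ (3 * r) * odd_factor n (zt t))))"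
proof -
  have "laurent_rep (odd_factor n z_lp) (\<lambda>t. odd_factor n (zt t))"
  proof (cases "odd n")
    case True
    then show ?thesis unfolding odd_factor_def
      by (simp only: simp_thms if_True)
         (intro laurent_rep_mult laurent_rep_add laurent_rep_diff laurent_rep_numeral laurent_rep_z_lp)
  next
    case False
    then show ?thesis unfolding odd_factor_def by (simp only: simp_thms if_False laurent_rep_numeral)
  qed
  then show ?thesis unfolding det_entry_def
    by (intro laurent_rep_mult laurent_rep_power laurent_rep_diff laurent_rep_numeral laurent_rep_z_lp)
qed

text \<open>Both sides apply the sign functional in \<open>k\<close> variables to one function,
  expanded on the left as an alternant in the values of \<open>g\<close> and on the right as a
  product of alternants in \<open>z\<close> and \<open>w\<close>. By
  \<open>has_sgn_sum_antisym\<close> the factor \<open>u - 1/u\<close> turns the functional into a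
  constant term.\<close>

lemma L_term_sum:
  fixes n m :: nat
  defines "k \<equiv> n div 2"
  shows "(\<Sum>\<rho> | \<rho> permutes {..<n}. of_int (sign \<rho>) * L_term n m \<rho>) =
    (\<Prod>j<n. (- 1) ^ j) * (if odd n then 2 ^ m else 1) *
    (\<Sum>\<pi> | \<pi> permutes {..<k}. \<Sum>\<rho> | \<rho> permutes {..<k}. of_int (sign \<pi>) * of_int (sign \<rho>) *
      (\<Prod>i<k. fls_nth (z_lp * det_entry n m k (\<rho> i) (\<pi> i)) 0))"
proof -
  define s :: rat where "s = (\<Prod>j<n. (- 1) ^ j)"
  define C :: rat where "C = (if odd n then 2 ^ m else 1)"
  define c where "c \<rho> = of_int (sign \<rho>) * (if odd n then 2 ^ (m + \<rho> (n - 1)) else (1::rat))" for \<rho> :: "nat \<Rightarrow> nat"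
  define d where "d x = s * C * (of_int (sign (fst x)) * of_int (sign (snd x)))" for x :: "(nat \<Rightarrow> nat) \<times> (nat \<Rightarrow> nat)"
  let ?S = "{\<rho>. \<rho> permutes {..<n}}" and ?A = "{\<rho>. \<rho> permutes {..<k}}"
  define F where "F \<rho> i t = ((1 + t) ^ m * g_fun t ^ \<rho> (2 * i)) * ((1 + 1 / t) ^ m * g_fun (1 / t) ^ \<rho> (2 * i + 1))"
    for \<rho> :: "nat \<Rightarrow> nat" and i and t :: rat
  define G where "G x i t = (t - 1 / t) * ((zt t - 1) * (zt t ^ m *
      (zt t ^ (fst x i + k - 1 - snd x i) * (zt t - 1) ^ (3 * snd x i) * odd_factor n (zt t))))"
    for x :: "(nat \<Rightarrow> nat) \<times> (nat \<Rightarrow> nat)" and i and t :: rat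
  have "(\<Sum>\<rho>\<in>?S. c \<rho> * (\<Prod>i<k. pair_ct m (\<rho> (2 * i)) (\<rho> (2 * i + 1)))) =
      (\<Sum>x\<in>?A \<times> ?A. d x * (\<Prod>i<k. fls_nth (z_lp * det_entry n m k (snd x i) (fst x i)) 0))"
  \<comment> \<open>On positive rationals neither \<open>t\<close> nor \<open>zt t\<close>
    vanishes.\<close>
  proof (rule sgn_sum_transfer[where F = F and G = G and U = "{0<..}" and
        f = "\<lambda>\<rho> i. pair_fls m (\<rho> (2 * i)) (\<rho> (2 * i + 1))" and
        g = "\<lambda>x i. (fls_X - inverse fls_X) * det_entry n m k (snd x i) (fst x i)"])
    show "laurent_rep (pair_fls m (\<rho> (2 * i)) (\<rho> (2 * i + 1))) (F \<rho> i) \<and>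
        has_sgn_sum (pair_fls m (\<rho> (2 * i)) (\<rho> (2 * i + 1))) (pair_ct m (\<rho> (2 * i)) (\<rho> (2 * i + 1)))" for \<rho> i
      unfolding F_def[abs_def] using laurent_rep_pair_fls has_sgn_sum_pair_fls by blast
    show "laurent_rep ((fls_X - inverse fls_X) * det_entry n m k (snd x i) (fst x i)) (G x i) \<and>
        has_sgn_sum ((fls_X - inverse fls_X) * det_entry n m k (snd x i) (fst x i))
          (fls_nth (z_lp * det_entry n m k (snd x i) (fst x i)) 0)" for x i
      unfolding G_def[abs_def]
      by (intro conjI laurent_rep_mult laurent_rep_diff laurent_rep_X laurent_rep_det_entry
          has_sgn_sum_antisym[OF laurent_rep_det_entry])
    fix t :: "nat \<Rightarrow> rat"
    assume "\<And>i. i < k \<Longrightarrow> t i \<in> {0<..}"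
    then have t: "t i \<noteq> 0 \<and> zt (t i) \<noteq> 0" if "i < k" for i
      using that by (fastforce simp: zt_def add_pos_pos less_imp_neq[symmetric])
    let ?z = "\<lambda>i. zt (t i)" and ?w = "\<lambda>i. (zt (t i) - 1) ^ 3 / zt (t i)"
    \<comment> \<open>Even places hold \<open>g(t)\<close> and odd places \<open>g(1/t)\<close>; the
      default 2 is \<open>g(1)\<close>, the value at the unpaired place \<open>n - 1\<close> for odd
      \<open>n\<close>.\<close>
    define y where "y i = (if i div 2 < k then if even i then g_fun (t (i div 2)) else g_fun (1 / t (i div 2)) else 2)" for i
    have y: "i < k \<Longrightarrow> y (2 * i) = g_fun (t i)" "i < k \<Longrightarrow> y (2 * i + 1) = g_fun (1 / t i)" "y (2 * k) = 2" for i
      by (simp_all add: y_def)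
    have 1: "c \<rho> * (\<Prod>i<k. F \<rho> i (t i)) = (\<Prod>i<k. ?z i ^ m) * C * (of_int (sign \<rho>) * (\<Prod>i<n. y i ^ \<rho> i))" for \<rho>
    proof -
      have "F \<rho> i (t i) = ?z i ^ m * (y (2 * i) ^ \<rho> (2 * i) * y (2 * i + 1) ^ \<rho> (2 * i + 1))" if "i < k" for i
      proof -
        have "?z i ^ m = (1 + t i) ^ m * (1 + 1 / t i) ^ m"
          using g_fun_sum_prod(4)[OF t[OF that, THEN conjunct1]] by (simp only: power_mult_distrib[symmetric])
        then show ?thesis unfolding F_def y(1,2)[OF that] by (simp only: mult_ac)
      qed
      then have "(\<Prod>i<k. F \<rho> i (t i)) =
          (\<Prod>i<k. ?z i ^ m) * (\<Prod>i<k. y (2 * i) ^ \<rho> (2 * i) * y (2 * i + 1) ^ \<rho> (2 * i + 1))"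
        by (simp add: prod.distrib)
      moreover have "(\<Prod>i<n. y i ^ \<rho> i) = (\<Prod>i<k. y (2 * i) ^ \<rho> (2 * i) * y (2 * i + 1) ^ \<rho> (2 * i + 1)) *
          (if odd n then y (n - 1) ^ \<rho> (n - 1) else 1)"
        unfolding k_def by (rule prod_lessThan_pairs)
      moreover have "odd n \<Longrightarrow> y (n - 1) = 2" using y(3) by (simp add: k_def)
      ultimately show ?thesis by (simp add: c_def C_def power_add)
    qed
    have 2: "G x i (t i) = ?z i ^ m * ((t i - 1 / t i) * (?z i - 1) * odd_factor n (?z i)) *
        (?z i ^ fst x i * ?w i ^ snd x i * ?z i ^ (k - 1))" if "i < k" "snd x permutes {..<k}" for x i
    proof -
      \<comment> \<open>This keeps the exponent \<open>fst x i + k - 1 - snd x i\<close> an honest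
        difference, from which \<open>w ^ snd x i\<close> can be restored.\<close>
      have "snd x i < k" using permutes_in_image[OF that(2), of i] that(1) by simp
      then have "fst x i + k - 1 - snd x i + snd x i = fst x i + (k - 1)" by simp
      then have "?z i ^ (fst x i + k - 1 - snd x i) * ?z i ^ snd x i = ?z i ^ fst x i * ?z i ^ (k - 1)"
        by (simp only: power_add[symmetric])
      then have "?z i ^ (fst x i + k - 1 - snd x i) = ?z i ^ fst x i * ?z i ^ (k - 1) / ?z i ^ snd x i"
        using t[OF that(1)] by (simp add: field_simps)
      then show ?thesis by (simp add: G_def power_divide power_mult mult_ac)
    qed
    have "(\<Sum>\<rho>\<in>?S. c \<rho> * (\<Prod>i<k. F \<rho> i (t i))) = (\<Prod>i<k. ?z i ^ m) * C * alt_powers n y"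
      unfolding 1 alt_powers_def sum_distrib_left ..
    also have "\<dots> = s * C * (\<Prod>i<k. ?z i ^ m) * diff_prod n y"
      unfolding alt_powers_eq s_def by (simp only: mult_ac)
    also have "diff_prod n y = (\<Prod>i<k. (t i - 1 / t i) * (?z i - 1) * odd_factor n (?z i)) *
      (alt_powers k ?z * alt_powers k ?w * (\<Prod>i<k. ?z i ^ (k - 1)))"
      by (rule diff_prod_g_fun[OF t y meta_eq_to_obj_eq[OF k_def]])
    also have "alt_powers k ?z * alt_powers k ?w = (\<Sum>x\<in>?A \<times> ?A. of_int (sign (fst x)) * of_int (sign (snd x)) *
        (\<Prod>i<k. ?z i ^ fst x i * ?w i ^ snd x i))"
      unfolding alt_powers_def sum_product sum.cartesian_product prod.distrib
      by (intro sum.cong refl) (auto simp only: fst_conv snd_conv mult_ac)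
    also have "s * C * (\<Prod>i<k. ?z i ^ m) * ((\<Prod>i<k. (t i - 1 / t i) * (?z i - 1) * odd_factor n (?z i)) *
        ((\<Sum>x\<in>?A \<times> ?A. of_int (sign (fst x)) * of_int (sign (snd x)) *
          (\<Prod>i<k. ?z i ^ fst x i * ?w i ^ snd x i)) * (\<Prod>i<k. ?z i ^ (k - 1))))
        = (\<Sum>x\<in>?A \<times> ?A. d x * (\<Prod>i<k. G x i (t i)))"
      unfolding sum_distrib_left sum_distrib_right
    proof (rule sum.cong[OF refl])
      fix x assume "x \<in> ?A \<times> ?A"
      then have x: "snd x permutes {..<k}" by auto
      have "(\<Prod>i<k. G x i (t i)) = (\<Prod>i<k. ?z i ^ m * ((t i - 1 / t i) * (?z i - 1) * odd_factor n (?z i)) *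
        (?z i ^ fst x i * ?w i ^ snd x i * ?z i ^ (k - 1)))"
        by (intro prod.cong refl 2[OF _ x]) simp
      then show "s * C * (\<Prod>i<k. ?z i ^ m) * ((\<Prod>i<k. (t i - 1 / t i) * (?z i - 1) * odd_factor n (?z i)) *
        (of_int (sign (fst x)) * of_int (sign (snd x)) *
          (\<Prod>i<k. ?z i ^ fst x i * ?w i ^ snd x i) * (\<Prod>i<k. ?z i ^ (k - 1))))
        = d x * (\<Prod>i<k. G x i (t i))"
        unfolding d_def by (simp only: prod.distrib mult_ac)
    qed
    finally show "(\<Sum>\<rho>\<in>?S. c \<rho> * (\<Prod>i<k. F \<rho> i (t i))) = (\<Sum>x\<in>?A \<times> ?A. d x * (\<Prod>i<k. G x i (t i)))" .
  qed (auto simp: finite_permutations infinite_Ioi)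
  also have "\<dots> = (\<Sum>\<pi>\<in>?A. \<Sum>\<rho>\<in>?A. s * C * (of_int (sign \<pi>) * of_int (sign \<rho>)) *
      (\<Prod>i<k. fls_nth (z_lp * det_entry n m k (\<rho> i) (\<pi> i)) 0))"
    unfolding d_def sum.cartesian_product by (intro sum.cong refl) auto
  finally show ?thesis
    unfolding L_term_def c_def s_def[symmetric] C_def[symmetric] k_def[symmetric]
    by (simp only: sum_distrib_left mult_ac)
qed

text \<open>For a fixed row permutation \<open>\<rho>\<close> the substitution
  \<open>\<pi> = \<sigma> \<circ> \<rho>\<close> cancels the sign of \<open>\<rho>\<close> and
  leaves the Leibniz formula, so all \<open>k!\<close> choices of \<open>\<rho>\<close> give the
  same determinant.\<close>

lemma double_perm_sum_det:
  fixes e :: "nat \<Rightarrow> nat \<Rightarrow> 'a::{comm_ring_1,ring_char_0}"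
  shows "(\<Sum>\<pi> | \<pi> permutes {..<k}. \<Sum>\<rho> | \<rho> permutes {..<k}. of_int (sign \<pi>) * of_int (sign \<rho>) *
      (\<Prod>i<k. e (\<rho> i) (\<pi> i))) = fact k * det (mat k k (\<lambda>(i, j). e i j))"
proof -
  let ?A = "{\<rho>. \<rho> permutes {..<k}}"
  let ?D = "\<Sum>\<sigma>\<in>?A. of_int (sign \<sigma>) * (\<Prod>j<k. e j (\<sigma> j))"
  have "(\<Sum>\<pi>\<in>?A. of_int (sign \<pi>) * of_int (sign \<rho>) * (\<Prod>i<k. e (\<rho> i) (\<pi> i))) = ?D"
    if \<rho>: "\<rho> permutes {..<k}" for \<rho>
  proof -
    have sgn: "of_int (sign \<rho>) * of_int (sign \<rho>) = (1 :: 'a)"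
      by (metis of_int_1 of_int_mult sign_idempotent)
    have prod_eq: "(\<Prod>i<k. e (\<rho> i) ((\<sigma> \<circ> \<rho>) i)) = (\<Prod>j<k. e j (\<sigma> j))" for \<sigma>
      by (subst (2) prod.permute[OF \<rho>]) (simp only: o_def)
    have "(\<Sum>\<pi>\<in>?A. of_int (sign \<pi>) * (\<Prod>i<k. e (\<rho> i) (\<pi> i))) =
        of_int (sign \<rho>) * (\<Sum>\<sigma>\<in>?A. of_int (sign \<sigma>) * (\<Prod>i<k. e (\<rho> i) ((\<sigma> \<circ> \<rho>) i)))"
      using perm_sum_compose[OF finite_lessThan \<rho>, where P = "\<lambda>_. True" and F = "\<lambda>\<pi>. \<Prod>i<k. e (\<rho> i) (\<pi> i)"]
      by simp
    also have "\<dots> = of_int (sign \<rho>) * ?D" unfolding prod_eq ..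
    finally have eq: "(\<Sum>\<pi>\<in>?A. of_int (sign \<pi>) * (\<Prod>i<k. e (\<rho> i) (\<pi> i))) = of_int (sign \<rho>) * ?D" .
    have "(\<Sum>\<pi>\<in>?A. of_int (sign \<pi>) * of_int (sign \<rho>) * (\<Prod>i<k. e (\<rho> i) (\<pi> i))) =
        of_int (sign \<rho>) * (\<Sum>\<pi>\<in>?A. of_int (sign \<pi>) * (\<Prod>i<k. e (\<rho> i) (\<pi> i)))"
      unfolding sum_distrib_left by (simp only: mult_ac)
    also have "\<dots> = ?D" unfolding eq mult.assoc[symmetric] sgn by (rule mult_1_left)
    finally show ?thesis .
  qed
  then have "(\<Sum>\<rho>\<in>?A. \<Sum>\<pi>\<in>?A. of_int (sign \<pi>) * of_int (sign \<rho>) * (\<Prod>i<k. e (\<rho> i) (\<pi> i))) = (\<Sum>\<rho>\<in>?A. ?D)"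
    by (rule sum.cong[OF refl]) simp
  also have "\<dots> = fact k * ?D" using card_permutations[of "{..<k}" k] by simp
  also have "?D = det (mat k k (\<lambda>(i, j). e i j))"
  proof -
    have "det (mat k k (\<lambda>(i, j). e i j)) =
        (\<Sum>p | p permutes {0..<k}. of_int (sign p) * (\<Prod>i = 0..<k. index_mat (mat k k (\<lambda>(i, j). e i j)) (i, p i)))"
      by (subst det_def'[of _ k]) auto
    also have "\<dots> = ?D" unfolding atLeast0LessThan
    proof (intro sum.cong refl arg_cong2[where f = "(*)"] prod.cong)
      fix p i assume "p \<in> {p. p permutes {..<k}}" "i \<in> {..<k}"
      then have "i < k" "p i < k" using permutes_in_image[of p "{..<k}" i] by auto
      then show "index_mat (mat k k (\<lambda>(i, j). e i j)) (i, p i) = e i (p i)" by simp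
    qed
    finally show ?thesis ..
  qed
  finally show ?thesis by (subst sum.swap)
qed

text \<open>The sign occurs once in \<open>L_const_perm_sum\<close> and once in
  \<open>L_term_sum\<close>, and cancels. The \<open>k!\<close> of the Pfaffian cancels that of the
  double sum, while its \<open>2 ^ k\<close> stays as denominator.\<close>

lemma L_const_det:
  "L_const n m = (if odd n then 2 ^ m else 1) / 2 ^ (n div 2) *
     det_ct (n div 2) (\<lambda>i j. z_lp ^ (m + n div 2 + j - i) * (z_lp - 1) ^ (3 * i - 2) * odd_factor n z_lp)"
proof -
  define k where "k = n div 2"
  define s :: rat where "s = (\<Prod>j<n. (- 1) ^ j)"
  define C :: rat where "C = (if odd n then 2 ^ m else 1)"
  let ?a = "\<lambda>i j. z_lp ^ (m + k + j - i) * (z_lp - 1) ^ (3 * i - 2) * odd_factor n z_lp"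
  have ss: "s * s = 1" unfolding s_def prod.distrib[symmetric] by (simp flip: power_mult_distrib)
  \<comment> \<open>In indices from 1 the exponent \<open>3 * i + 1\<close> reads
    \<open>3 * i - 2\<close>; its extra 1 is the leading \<open>z_lp - 1\<close>, and the outer
    \<open>z_lp\<close> balances the \<open>- 1\<close> in \<open>j + k - 1 - i\<close>.\<close>
  have entry: "z_lp * det_entry n m k i j = ?a (i + 1) (j + 1)" if "i < k" for i j
  proof -
    have "m + k + (j + 1) - (i + 1) = Suc (m + (j + k - 1 - i))" "3 * (i + 1) - 2 = Suc (3 * i)"
      using that by auto
    then show ?thesis by (simp only: det_entry_def power_Suc power_add mult_ac)
  qed
  have "det (mat k k (\<lambda>(i, j). fls_nth (z_lp * det_entry n m k i j) 0)) = det_ct k ?a"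
    unfolding det_ct_def by (intro arg_cong[where f = det] eq_matI) (auto simp: entry)
  then have "(\<Sum>\<rho> | \<rho> permutes {..<n}. of_int (sign \<rho>) * L_term n m \<rho>) = s * C * (fact k * det_ct k ?a)"
    using L_term_sum[of n m] double_perm_sum_det[where k = k and e = "\<lambda>i j. fls_nth (z_lp * det_entry n m k i j) 0"]
    unfolding s_def C_def k_def by simp
  then have "2 ^ k * fact k * L_const n m = s * (s * C * (fact k * det_ct k ?a))"
    using L_const_perm_sum[of n m] unfolding s_def k_def by simp
  also have "\<dots> = (s * s) * (C * (fact k * det_ct k ?a))" by (simp only: mult_ac)
  finally have "2 ^ k * fact k * L_const n m = C * (fact k * det_ct k ?a)" using ss by simp
  then have "L_const n m = C / 2 ^ k * det_ct k ?a" by (simp add: field_simps)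
  then show ?thesis by (simp only: C_def k_def)
qed

theorem mainTheorem4:
  fixes n m k :: nat
  assumes "n \<ge> 1"
  shows "(n = 2 * k \<longrightarrow>
           L_const n m = 1 / 2 ^ k *
             det_ct k (\<lambda>i j. z_lp ^ (m + k + j - i) * (z_lp - 1) ^ (3 * i - 2))) \<and>
         (n = 2 * k + 1 \<longrightarrow>
           L_const n m = 2 ^ m / 2 ^ k *
             det_ct k (\<lambda>i j. z_lp ^ (m + k + j - i) * (z_lp - 1) ^ (3 * i - 2) *
                             (2 * z_lp + 1) * (4 - z_lp)))"
  using L_const_det[of n m] by (auto simp: odd_factor_def mult.assoc)

end
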